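(* Let $n\ge 1$. The $\mathfrak{S}_n$-module $A(X_{\Sigma_n})=A(\mathsf{B}_n)$ has permutation basis $FY(\mathsf{B}_n)$, and for each $0\le k\le n-1$ its homogeneous component $A^k(\mathsf{B}_n)$ has permutation basis $FY^k(\mathsf{B}_n)$. That is, (the classes of) the monomials in $FY(\mathsf{B}_n)$ (respectively $FY^k(\mathsf{B}_n)$) form a $\mathbb{Q}$-basis of $A(\mathsf{B}_n)$ (respectively $A^k(\mathsf{B}_n)$) that is permuted by the action of $\mathfrak{S}_n$.
   Context: Write $[n]=\{1,\dots,n\}$. The Boolean matroid $\mathsf{B}_n$ is the matroid on $[n]$ in which every subset is independent; its flats are all subsets of $[n]$. Its Chow ring is the graded $\mathbb{Q}$-algebra (each $x_F$ in degree $1$) $$A(\mathsf{B}_n)=\mathbb{Q}[x_F:\ \emptyset\ne F\subseteq[n]]\Big/\Big(\big\langle x_Fx_G: F,G \text{ incomparable under inclusion}\big\rangle+\big\langle \textstyle\sum_{F\ni i}x_F: 1\le i\le n\big\rangle\Big),$$ with $A^k(\mathsf{B}_n)$ its degree $k$ component. $\mathfrak{S}_n$ acts on it by $\sigma\cdot x_F=x_{\sigma(F)}$. Here $\Sigma_n$ is the normal fan of the permutahedron $\Pi_n=\mathrm{conv}\{(\sigma_1,\dots,\sigma_n):\sigma\in\mathfrak{S}_n\}$ and $X_{\Sigma_n}$ is the associated toric variety (the permutahedral variety); its Chow ring $A(X_{\Sigma_n})$ over $\mathbb{Q}$ is identified with $A(\mathsf{B}_n)$ (by eliminating $x_{[n]}$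 from the presentation above one obtains the Stanley--Reisner ring of $\Sigma_n$ modulo the linear relations $\sum_{F\ni i}x_F-\sum_{F\ni j}x_F$, where $F$ runs over the proper nonempty subsets), and is isomorphic to $H^*(X_{\Sigma_n},\mathbb{Q})$ as an $\mathfrak{S}_n$-module. $FY(\mathsf{B}_n)$ is the set of monomials $x_{F_1}^{a_1}x_{F_2}^{a_2}\cdots x_{F_\ell}^{a_\ell}$ with $0\le \ell\le n$, $\emptyset=F_0\subsetneq F_1\subsetneq\cdots\subsetneq F_\ell\subseteq[n]$ and $1\le a_i\le |F_i|-|F_{i-1}|-1$ for all $1\le i\le\ell$ (the case $\ell=0$ gives the monomial $1$). $FY^k(\mathsf{B}_n)$ is the subset of monomials of degree $k$. A permutation basis of a $G$-module is a basis that is mapped to itself by every element of $G$. *)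

theory Defs
  imports
    "HOL-Library.Poly_Mapping"
    "HOL-Algebra.QuotRing"
    "HOL-Algebra.Group_Action"
    "HOL-Algebra.Sym_Groups"
    "HOL-Algebra.Algebraic_Closure_Type"
    "Jordan_Normal_Form.Missing_VectorSpace"
begin

section \<open>Permutation bases of linear representations\<close>

text \<open>
  The restriction is only there because \<^locale>\<open>group_action\<close> asks for extensional functions.
\<close>

definition linear_rep ::
    "('g, 'm) monoid_scheme \<Rightarrow> ('k, 'l) ring_scheme \<Rightarrow> ('k, 'v, 'w) module_scheme \<Rightarrow> ('g \<Rightarrow> 'v \<Rightarrow> 'v) \<Rightarrow> bool"
  where "linear_rep G K V \<phi> \<longleftrightarrow>
    vectorspace K V \<and>
    group_action G (carrier V) (\<lambda>g. restrict (\<phi> g) (carrier V)) \<and>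
    (\<forall>g \<in> carrier G. \<phi> g \<in> module_hom K V V)"

definition permutation_basis ::
    "('g, 'm) monoid_scheme \<Rightarrow> ('k, 'l) ring_scheme \<Rightarrow> ('k, 'v, 'w) module_scheme \<Rightarrow> ('g \<Rightarrow> 'v \<Rightarrow> 'v) \<Rightarrow> 'v set \<Rightarrow> bool"
  where "permutation_basis G K V \<phi> B \<longleftrightarrow>
    linear_rep G K V \<phi> \<and> vectorspace.basis K V B \<and> (\<forall>g \<in> carrier G. \<phi> g ` B = B)"


section \<open>The polynomial ring on the nonempty flats of the Boolean matroid\<close>

text \<open>
  A monomial is a finitely supported exponent function on sets of natural numbers, a polynomial a
  finitely supported coefficient function on monomials; the product is convolution.
\<close>

type_synonym flat_poly = "(nat set \<Rightarrow>\<^sub>0 nat) \<Rightarrow>\<^sub>0 rat"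

definition rat_field :: "rat ring"
  where "rat_field = ring_of_type_algebra"

definition nonempty_flats :: "nat \<Rightarrow> nat set set"
  where "nonempty_flats n = {F. F \<noteq> {} \<and> F \<subseteq> {1..n}}"

definition poly_const :: "rat \<Rightarrow> flat_poly"
  where "poly_const c = Poly_Mapping.single 0 c"

definition poly_var :: "nat set \<Rightarrow> flat_poly"
  where "poly_var F = Poly_Mapping.single (Poly_Mapping.single F 1) 1"

definition flat_poly_ring :: "nat \<Rightarrow> flat_poly ring"
  where "flat_poly_ring n =
    ring_of_type_algebra \<lparr>carrier := {p. \<forall>m \<in> Poly_Mapping.keys p. Poly_Mapping.keys m \<subseteq> nonempty_flats n}\<rparr>"

definition homogeneous_poly :: "nat \<Rightarrow> flat_poly \<Rightarrow> bool"
  where "homogeneous_poly k p \<longleftrightarrow> (\<forall>m \<in> Poly_Mapping.keys p. (\<Sum>F \<in> Poly_Mapping.keys m. Poly_Mapping.lookup m F) = k)"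

text \<open>The substitution \<open>x\<^sub>F \<mapsto> x\<^bsub>\<sigma>(F)\<^esub>\<close>.\<close>

definition perm_poly :: "(nat \<Rightarrow> nat) \<Rightarrow> flat_poly \<Rightarrow> flat_poly"
  where "perm_poly \<sigma> p =
    (\<Sum>m \<in> Poly_Mapping.keys p. poly_const (Poly_Mapping.lookup p m) * (\<Prod>F \<in> Poly_Mapping.keys m. poly_var (\<sigma> ` F) ^ Poly_Mapping.lookup m F))"

lemma perm_poly_var: "perm_poly \<sigma> (poly_var F) = poly_var (\<sigma> ` F)"
  by (simp add: perm_poly_def poly_var_def poly_const_def)


section \<open>The Chow ring of the Boolean matroid\<close>

definition chow_ideal :: "nat \<Rightarrow> flat_poly set"
  where "chow_ideal n =
    Idl\<^bsub>flat_poly_ring n\<^esub> {poly_var F * poly_var G | F G.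
        F \<in> nonempty_flats n \<and> G \<in> nonempty_flats n \<and> \<not> F \<subseteq> G \<and> \<not> G \<subseteq> F}
    <+>\<^bsub>flat_poly_ring n\<^esub>
    Idl\<^bsub>flat_poly_ring n\<^esub> {(\<Sum>F \<in> {F \<in> nonempty_flats n. i \<in> F}. poly_var F) | i. i \<in> {1..n}}"

definition chow_class :: "nat \<Rightarrow> flat_poly \<Rightarrow> flat_poly set"
  where "chow_class n p = chow_ideal n +>\<^bsub>flat_poly_ring n\<^esub> p"

definition chow_algebra :: "nat \<Rightarrow> (rat, flat_poly set) module"
  where "chow_algebra n = (let A = flat_poly_ring n Quot chow_ideal n in
    \<lparr>carrier = carrier A, monoid.mult = monoid.mult A, one = one A, zero = zero A, add = add A,
     module.smult = (\<lambda>c a. chow_class n (poly_const c) \<otimes>\<^bsub>A\<^esub> a)\<rparr>)"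

definition chow_component :: "nat \<Rightarrow> nat \<Rightarrow> (rat, flat_poly set) module"
  where "chow_component n k = chow_algebra n
    \<lparr>carrier := chow_class n ` {p \<in> carrier (flat_poly_ring n). homogeneous_poly k p}\<rparr>"

text \<open>
  Elements of the Chow ring are cosets, and \<open>\<sigma>\<close> acts on them elementwise. As \<open>\<sigma>\<close> maps the ideal onto
  itself, this sends the class of \<open>p\<close> to the class of \<open>\<sigma> \<cdot> p\<close>.
\<close>

definition chow_action :: "(nat \<Rightarrow> nat) \<Rightarrow> flat_poly set \<Rightarrow> flat_poly set"
  where "chow_action \<sigma> C = perm_poly \<sigma> ` C"


section \<open>Feichtner--Yuzvinsky monomials\<close>

text \<open>
  The natural-number subtractions below never truncate, since the chain of finite sets is strict.
\<close>

definition FY :: "nat \<Rightarrow> flat_poly set"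
  where "FY n = {(\<Prod>i = 1..l. poly_var (F i) ^ a i) | (l :: nat) (F :: nat \<Rightarrow> nat set) (a :: nat \<Rightarrow> nat).
    l \<le> n \<and> F 0 = {} \<and> F l \<subseteq> {1..n} \<and>
    (\<forall>i \<in> {1..l}. F (i - 1) \<subset> F i \<and> 1 \<le> a i \<and> a i \<le> card (F i) - card (F (i - 1)) - 1)}"

definition FY_deg :: "nat \<Rightarrow> nat \<Rightarrow> flat_poly set"
  where "FY_deg n k = {p \<in> FY n. homogeneous_poly k p}"

end

theory Submission
  imports Defs "HOL-Library.Function_Algebras"
begin

text \<open>
  Spanning: write \<open>h\<^sub>G\<close> for the sum of the variables of all flats containing \<open>G\<close>. For \<open>F \<subset> G\<close>, where
  \<open>F\<close> may be empty, \<open>x\<^sub>F h\<^sub>G^(|G| - |F|)\<close> vanishes in the Chow ring, so a monomial in which the exponent of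
  \<open>x\<^sub>G\<close> is too large can be replaced by monomials of the same degree in larger flats.

  Independence: each permutation \<open>w\<close> gives a complete flag and a point whose coordinates vanish off the
  flag and at which the \<open>i\<close>-th linear form takes the value \<open>i\<close>. Scaled by a parameter \<open>s\<close>, these points
  kill the incomparable products and send each linear form into the multiples of \<open>s\<close>, so up to terms
  of lower degree they see the Chow ring. Spanning then shows that the values of the
  Feichtner--Yuzvinsky monomials generate all functions on the \<open>n!\<close> points. There are at most \<open>n!\<close>
  such monomials, hence their values are linearly independent; comparing coefficients of powers of \<open>s\<close>
  transfers this to the Chow ring.
\<close>

section \<open>Evaluation of polynomials\<close>

text \<open>The obstacle is independence: the flag points do not factor through the Chow ring, as
  the i-th linear form takes the value i there and not 0. Degree repairs this. An element of the
  ideal evaluates to s times the evaluation of another polynomial, so its coefficient at s^k is a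
  coefficient at s^(k-1), and by spanning that is a combination of values of Feichtner-Yuzvinsky
  monomials of degree below k. Once the values of the monomials of all degrees together are
  independent, the degree k part of a relation has to vanish. Geometrically, the linear forms map a
  union of n! coordinate subspaces, one per complete flag, to affine n-space; the n! points are the
  fibre over (1,...,n), and the Chow ring belongs to the fibre over 0. Any distinct nonzero values
  would do in place of 1,...,n: they make all coordinates on the flag nonzero, which separates the
  points. The power of h_G vanishes because the elements of G - F can be adjoined one at a time,
  each at the price of one factor. The count n! is a telescoping sum based on (j-1)/j! = 1/(j-1)! -
  1/j!.\<close>

definition eval_monom :: "('b \<Rightarrow> 'a::comm_monoid_mult) \<Rightarrow> ('b \<Rightarrow>\<^sub>0 nat) \<Rightarrow> 'a"
  where "eval_monom f m = (\<Prod>x \<in> Poly_Mapping.keys m. f x ^ Poly_Mapping.lookup m x)"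

text \<open>The coefficient map \<open>\<kappa>\<close> stays generic because there are two targets:
  the polynomial ring itself, for \<open>perm_poly\<close>, and \<open>rat poly\<close>, for
  \<open>eval_flag\<close>.\<close>

definition eval_poly :: "('c::comm_ring_1 \<Rightarrow> 'a::comm_ring_1) \<Rightarrow> ('b \<Rightarrow> 'a) \<Rightarrow> (('b \<Rightarrow>\<^sub>0 nat) \<Rightarrow>\<^sub>0 'c) \<Rightarrow> 'a"
  where "eval_poly \<kappa> f p = (\<Sum>m \<in> Poly_Mapping.keys p. \<kappa> (Poly_Mapping.lookup p m) * eval_monom f m)"

lemma eval_monom_superset:
  "finite A \<Longrightarrow> Poly_Mapping.keys m \<subseteq> A \<Longrightarrow> eval_monom f m = (\<Prod>x\<in>A. f x ^ Poly_Mapping.lookup m x)"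
  unfolding eval_monom_def by (rule prod.mono_neutral_left) (auto simp: in_keys_iff)

lemma eval_monom_0 [simp]: "eval_monom f 0 = 1"
  by (simp add: eval_monom_def)

lemma eval_monom_single [simp]: "eval_monom f (Poly_Mapping.single x k) = f x ^ k"
  by (simp add: eval_monom_def)

lemma eval_monom_add: "eval_monom f (m + m') = eval_monom f m * eval_monom f m'"
proof -
  let ?A = "Poly_Mapping.keys m \<union> Poly_Mapping.keys m'"
  have "Poly_Mapping.keys (m + m') \<subseteq> ?A" by (rule keys_add)
  then show ?thesis
    by (simp add: eval_monom_superset[of ?A] lookup_add power_add prod.distrib)
qed

lemma eval_monom_sum: "finite A \<Longrightarrow> eval_monom f (sum g A) = (\<Prod>i\<in>A. eval_monom f (g i))"
  by (induction A rule: finite_induct) (auto simp: eval_monom_add)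

lemma poly_mapping_sum_single: "(\<Sum>x\<in>Poly_Mapping.keys p. Poly_Mapping.single x (Poly_Mapping.lookup p x)) = p"
  by (rule poly_mapping_eqI)
    (auto simp: lookup_sum lookup_single when_def not_in_keys_iff_lookup_eq_zero)

locale coefficient_hom =
  fixes hom :: "'c::comm_ring_1 \<Rightarrow> 'a::comm_ring_1"
  assumes hom_add: "hom (a + b) = hom a + hom b"
    and hom_mult: "hom (a * b) = hom a * hom b"
    and hom_one [simp]: "hom 1 = 1"
begin

lemma hom_zero [simp]: "hom 0 = 0"
  using hom_add[of 0 0] by simp

lemma hom_uminus: "hom (- a) = - hom a"
  using hom_add[of a "- a"] by (simp add: eq_neg_iff_add_eq_0 add.commute)

lemma eval_poly_superset:
  "finite A \<Longrightarrow> Poly_Mapping.keys p \<subseteq> A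
    \<Longrightarrow> eval_poly hom f p = (\<Sum>m\<in>A. hom (Poly_Mapping.lookup p m) * eval_monom f m)"
  unfolding eval_poly_def by (rule sum.mono_neutral_left) (auto simp: in_keys_iff)

lemma eval_poly_0 [simp]: "eval_poly hom f 0 = 0"
  by (simp add: eval_poly_def)

lemma eval_poly_single [simp]: "eval_poly hom f (Poly_Mapping.single m c) = hom c * eval_monom f m"
  by (simp add: eval_poly_def)

lemma eval_poly_1 [simp]: "eval_poly hom f 1 = 1"
  by (simp add: eval_poly_single[of f 0 1, simplified])

lemma eval_poly_add: "eval_poly hom f (p + q) = eval_poly hom f p + eval_poly hom f q"
proof -
  let ?A = "Poly_Mapping.keys p \<union> Poly_Mapping.keys q"
  have "Poly_Mapping.keys (p + q) \<subseteq> ?A" by (rule keys_add)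
  then show ?thesis
    by (simp add: eval_poly_superset[of ?A] lookup_add hom_add distrib_right sum.distrib)
qed

lemma eval_poly_sum: "eval_poly hom f (sum g A) = (\<Sum>i\<in>A. eval_poly hom f (g i))"
  by (induction A rule: infinite_finite_induct) (auto simp: eval_poly_add)

lemma eval_poly_mult_single:
  "eval_poly hom f (Poly_Mapping.single m c * q) = hom c * eval_monom f m * eval_poly hom f q"
proof -
  have "Poly_Mapping.single m c * q
      = (\<Sum>k\<in>Poly_Mapping.keys q. Poly_Mapping.single (m + k) (c * Poly_Mapping.lookup q k))"
    by (subst (1) poly_mapping_sum_single[of q, symmetric]) (simp add: sum_distrib_left mult_single)
  then have "eval_poly hom f (Poly_Mapping.single m c * q)
      = (\<Sum>k\<in>Poly_Mapping.keys q. hom (c * Poly_Mapping.lookup q k) * eval_monom f (m + k))"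
    by (simp only: eval_poly_sum eval_poly_single)
  also have "\<dots> = hom c * eval_monom f m * eval_poly hom f q"
    unfolding eval_poly_def sum_distrib_left
    by (rule sum.cong) (simp_all add: hom_mult eval_monom_add mult_ac)
  finally show ?thesis .
qed

lemma eval_poly_mult: "eval_poly hom f (p * q) = eval_poly hom f p * eval_poly hom f q"
proof -
  have "p * q = (\<Sum>m\<in>Poly_Mapping.keys p. Poly_Mapping.single m (Poly_Mapping.lookup p m) * q)"
    by (subst (1) poly_mapping_sum_single[of p, symmetric]) (simp add: sum_distrib_right)
  then show ?thesis
    by (simp add: eval_poly_sum eval_poly_mult_single)
      (simp add: eval_poly_def sum_distrib_right)
qed

lemma eval_poly_prod: "eval_poly hom f (prod g A) = (\<Prod>i\<in>A. eval_poly hom f (g i))"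
  by (induction A rule: infinite_finite_induct) (auto simp: eval_poly_mult)

lemma eval_poly_uminus: "eval_poly hom f (- p) = - eval_poly hom f p"
  using eval_poly_add[of f p "- p"] by (simp add: eq_neg_iff_add_eq_0 add.commute)

lemma eval_poly_diff: "eval_poly hom f (p - q) = eval_poly hom f p - eval_poly hom f q"
  using eval_poly_add[of f p "- q"] by (simp add: eval_poly_uminus)

end

section \<open>Monomials, their degree, and the polynomial ring on nonempty flats\<close>

definition monomial :: "(nat set \<Rightarrow>\<^sub>0 nat) \<Rightarrow> flat_poly"
  where "monomial m = Poly_Mapping.single m 1"

definition total_degree :: "(nat set \<Rightarrow>\<^sub>0 nat) \<Rightarrow> nat"
  where "total_degree m = (\<Sum>F \<in> Poly_Mapping.keys m. Poly_Mapping.lookup m F)"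

lemma total_degree_superset:
  "finite A \<Longrightarrow> Poly_Mapping.keys m \<subseteq> A \<Longrightarrow> total_degree m = (\<Sum>F\<in>A. Poly_Mapping.lookup m F)"
  unfolding total_degree_def by (rule sum.mono_neutral_left) (auto simp: in_keys_iff)

lemma total_degree_0 [simp]: "total_degree 0 = 0"
  by (simp add: total_degree_def)

lemma total_degree_single [simp]: "total_degree (Poly_Mapping.single F k) = k"
  by (simp add: total_degree_def)

lemma total_degree_add: "total_degree (m + m') = total_degree m + total_degree m'"
  using keys_add[of m m']
  by (simp add: total_degree_superset[of "Poly_Mapping.keys m \<union> Poly_Mapping.keys m'"] lookup_add sum.distrib)

lemma monomial_0 [simp]: "monomial 0 = 1"
  by (simp add: monomial_def)

lemma monomial_add: "monomial (m + m') = monomial m * monomial m'"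
  by (simp add: monomial_def mult_single)

lemma monomial_inject [simp]: "monomial m = monomial m' \<longleftrightarrow> m = m'"
  by (auto simp: monomial_def) (metis keys_single one_neq_zero singleton_inject)

lemma monomial_single: "monomial (Poly_Mapping.single F k) = poly_var F ^ k"
proof (induction k)
  case (Suc k)
  have "Poly_Mapping.single F (Suc k) = Poly_Mapping.single F 1 + Poly_Mapping.single F k"
    by (simp flip: single_add)
  then show ?case
    using Suc by (simp add: monomial_add) (simp add: monomial_def poly_var_def)
qed simp

lemma eval_monom_poly_var: "eval_monom poly_var m = monomial m"
proof -
  have "monomial (\<Sum>F\<in>A. g F) = (\<Prod>F\<in>A. monomial (g F))" for g :: "nat set \<Rightarrow> nat set \<Rightarrow>\<^sub>0 nat" and A
    by (induction A rule: infinite_finite_induct) (auto simp: monomial_add)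
  from this[of "\<lambda>F. Poly_Mapping.single F (Poly_Mapping.lookup m F)" "Poly_Mapping.keys m"]
  show ?thesis
    by (simp add: poly_mapping_sum_single monomial_single eval_monom_def)
qed

lemma single_eq_const_monomial: "Poly_Mapping.single m c = poly_const c * monomial m"
  by (simp add: poly_const_def monomial_def mult_single)

lemma flat_poly_eq_sum: "p = (\<Sum>m\<in>Poly_Mapping.keys p. poly_const (Poly_Mapping.lookup p m) * monomial m)"
  using poly_mapping_sum_single[of p] by (simp add: single_eq_const_monomial)

global_interpretation poly_const: coefficient_hom poly_const
  by unfold_locales (auto simp: poly_const_def single_add mult_single)

text \<open>Reading the substitution as an evaluation makes it a ring homomorphism without further
  work.\<close>

lemma perm_poly_eq_eval_poly: "perm_poly \<sigma> = eval_poly poly_const (\<lambda>F. poly_var (\<sigma> ` F))"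
  by (rule ext) (simp add: perm_poly_def eval_poly_def eval_monom_def)

lemma homogeneous_poly_iff: "homogeneous_poly k p \<longleftrightarrow> (\<forall>m\<in>Poly_Mapping.keys p. total_degree m = k)"
  by (simp add: homogeneous_poly_def total_degree_def)

lemma homogeneous_monomial [simp]: "homogeneous_poly k (monomial m) \<longleftrightarrow> total_degree m = k"
  by (simp add: homogeneous_poly_iff monomial_def)

abbreviation flat_polys :: "nat \<Rightarrow> flat_poly set"
  where "flat_polys n \<equiv> carrier (flat_poly_ring n)"

lemma flat_polys_iff: "p \<in> flat_polys n \<longleftrightarrow> (\<forall>m\<in>Poly_Mapping.keys p. Poly_Mapping.keys m \<subseteq> nonempty_flats n)"
  by (simp add: flat_poly_ring_def)

lemma finite_nonempty_flats [simp]: "finite (nonempty_flats n)"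
  by (simp add: nonempty_flats_def)

lemma flat_polys_single: "Poly_Mapping.keys m \<subseteq> nonempty_flats n \<Longrightarrow> Poly_Mapping.single m c \<in> flat_polys n"
  by (auto simp: flat_polys_iff)

lemma flat_polys_monomial [simp]: "monomial m \<in> flat_polys n \<longleftrightarrow> Poly_Mapping.keys m \<subseteq> nonempty_flats n"
  by (auto simp: flat_polys_iff monomial_def)

lemma flat_polys_const [simp]: "poly_const c \<in> flat_polys n"
  by (simp add: poly_const_def flat_polys_single)

lemma flat_polys_var [simp]: "F \<in> nonempty_flats n \<Longrightarrow> poly_var F \<in> flat_polys n"
  unfolding poly_var_def by (rule flat_polys_single) simp

lemma flat_polys_0 [simp]: "0 \<in> flat_polys n"
  by (simp add: flat_polys_iff)

lemma flat_polys_1 [simp]: "1 \<in> flat_polys n"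
  using flat_polys_const[of 1 n] by (simp add: poly_const_def)

lemma flat_polys_add [simp]: "p \<in> flat_polys n \<Longrightarrow> q \<in> flat_polys n \<Longrightarrow> p + q \<in> flat_polys n"
  using keys_add[of p q] by (auto simp: flat_polys_iff)

lemma flat_polys_mult [simp]: "p \<in> flat_polys n \<Longrightarrow> q \<in> flat_polys n \<Longrightarrow> p * q \<in> flat_polys n"
  unfolding flat_polys_iff
proof
  fix m assume pq: "\<forall>m\<in>Poly_Mapping.keys p. Poly_Mapping.keys m \<subseteq> nonempty_flats n"
    "\<forall>m\<in>Poly_Mapping.keys q. Poly_Mapping.keys m \<subseteq> nonempty_flats n"
  assume "m \<in> Poly_Mapping.keys (p * q)"
  then obtain a b where "m = a + b" "a \<in> Poly_Mapping.keys p" "b \<in> Poly_Mapping.keys q"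
    using keys_mult by blast
  then show "Poly_Mapping.keys m \<subseteq> nonempty_flats n"
    using pq keys_add[of a b] by blast
qed

lemma flat_polys_uminus [simp]: "p \<in> flat_polys n \<Longrightarrow> - p \<in> flat_polys n"
  by (auto simp: flat_polys_iff in_keys_iff)

lemma flat_polys_diff [simp]: "p \<in> flat_polys n \<Longrightarrow> q \<in> flat_polys n \<Longrightarrow> p - q \<in> flat_polys n"
  using flat_polys_add[of p n "- q"] by simp

lemma flat_polys_sum [simp]: "(\<And>i. i \<in> A \<Longrightarrow> g i \<in> flat_polys n) \<Longrightarrow> sum g A \<in> flat_polys n"
  by (induction A rule: infinite_finite_induct) auto

lemma flat_polys_prod [simp]: "(\<And>i. i \<in> A \<Longrightarrow> g i \<in> flat_polys n) \<Longrightarrow> prod g A \<in> flat_polys n"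
  by (induction A rule: infinite_finite_induct) auto

lemma flat_polys_power [simp]: "p \<in> flat_polys n \<Longrightarrow> p ^ k \<in> flat_polys n"
  by (induction k) auto

lemma flat_poly_ring_simps [simp]:
  "p \<otimes>\<^bsub>flat_poly_ring n\<^esub> q = p * q" "p \<oplus>\<^bsub>flat_poly_ring n\<^esub> q = p + q"
  "\<one>\<^bsub>flat_poly_ring n\<^esub> = 1" "\<zero>\<^bsub>flat_poly_ring n\<^esub> = 0"
  by (simp_all add: flat_poly_ring_def ring_of_type_algebra_def)

lemma cring_flat_poly_ring: "cring (flat_poly_ring n)"
proof (rule cringI)
  show "abelian_group (flat_poly_ring n)"
  proof (rule abelian_groupI)
    fix x assume "x \<in> flat_polys n"
    then show "\<exists>y\<in>flat_polys n. y \<oplus>\<^bsub>flat_poly_ring n\<^esub> x = \<zero>\<^bsub>flat_poly_ring n\<^esub>"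
      by (intro bexI[of _ "- x"]) auto
  qed (auto simp: algebra_simps)
  show "comm_monoid (flat_poly_ring n)"
    by (rule comm_monoidI) (auto simp: algebra_simps)
qed (auto simp: algebra_simps)

section \<open>Relations in the Chow ring\<close>

context cring
begin

lemma subset_genideal_add:
  assumes "A \<subseteq> carrier R" "B \<subseteq> carrier R"
  shows "A \<subseteq> Idl A <+>\<^bsub>R\<^esub> Idl B" "B \<subseteq> Idl A <+>\<^bsub>R\<^esub> Idl B"
proof -
  interpret A: ideal "Idl A" R by (rule genideal_ideal[OF assms(1)])
  interpret B: ideal "Idl B" R by (rule genideal_ideal[OF assms(2)])
  have *: "x \<oplus> \<zero> \<in> Idl A <+>\<^bsub>R\<^esub> Idl B" if "x \<in> Idl A" for x
    unfolding set_add_def' using that B.zero_closed by blast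
  show "A \<subseteq> Idl A <+>\<^bsub>R\<^esub> Idl B"
  proof
    fix x assume "x \<in> A"
    then have "x \<in> Idl A" "x \<in> carrier R" using assms(1) genideal_self by auto
    then show "x \<in> Idl A <+>\<^bsub>R\<^esub> Idl B" using *[of x] by simp
  qed
  have *: "\<zero> \<oplus> x \<in> Idl A <+>\<^bsub>R\<^esub> Idl B" if "x \<in> Idl B" for x
    unfolding set_add_def' using that A.zero_closed by blast
  show "B \<subseteq> Idl A <+>\<^bsub>R\<^esub> Idl B"
  proof
    fix x assume "x \<in> B"
    then have "x \<in> Idl B" "x \<in> carrier R" using assms(2) genideal_self by auto
    then show "x \<in> Idl A <+>\<^bsub>R\<^esub> Idl B" using *[of x] by simp
  qed
qed

lemma genideal_add_minimal:
  assumes "ideal J R" "A \<subseteq> J" "B \<subseteq> J"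
  shows "Idl A <+>\<^bsub>R\<^esub> Idl B \<subseteq> J"
proof -
  interpret J: ideal J R by (rule assms(1))
  have "Idl A \<subseteq> J" "Idl B \<subseteq> J"
    using assms by (auto intro: genideal_minimal[THEN subsetD])
  then show ?thesis
    unfolding set_add_def' using J.a_closed by blast
qed

end

definition incomparable_products :: "nat \<Rightarrow> flat_poly set"
  where "incomparable_products n = {poly_var F * poly_var G | F G.
    F \<in> nonempty_flats n \<and> G \<in> nonempty_flats n \<and> \<not> F \<subseteq> G \<and> \<not> G \<subseteq> F}"

definition linear_relations :: "nat \<Rightarrow> flat_poly set"
  where "linear_relations n = {(\<Sum>F \<in> {F \<in> nonempty_flats n. i \<in> F}. poly_var F) | i. i \<in> {1..n}}"

lemma chow_ideal_eq:
  "chow_ideal n = Idl\<^bsub>flat_poly_ring n\<^esub> (incomparable_products n)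
    <+>\<^bsub>flat_poly_ring n\<^esub> Idl\<^bsub>flat_poly_ring n\<^esub> (linear_relations n)"
  by (simp add: chow_ideal_def incomparable_products_def linear_relations_def)

lemma generators_subset:
  "incomparable_products n \<subseteq> flat_polys n" "linear_relations n \<subseteq> flat_polys n"
  by (auto simp: incomparable_products_def linear_relations_def intro!: flat_polys_sum)

lemma ideal_chow_ideal: "ideal (chow_ideal n) (flat_poly_ring n)"
proof -
  interpret R: cring "flat_poly_ring n" by (rule cring_flat_poly_ring)
  show ?thesis
    unfolding chow_ideal_eq by (intro R.add_ideals R.genideal_ideal generators_subset)
qed

lemma chow_ideal_0 [simp]: "0 \<in> chow_ideal n"
  using additive_subgroup.zero_closed[OF ideal.axioms(1)[OF ideal_chow_ideal]] by simp

lemma chow_ideal_add: "p \<in> chow_ideal n \<Longrightarrow> q \<in> chow_ideal n \<Longrightarrow> p + q \<in> chow_ideal n"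
  using additive_subgroup.a_closed[OF ideal.axioms(1)[OF ideal_chow_ideal]] by simp

lemma chow_ideal_mult: "p \<in> chow_ideal n \<Longrightarrow> q \<in> flat_polys n \<Longrightarrow> q * p \<in> chow_ideal n"
  using ideal.I_l_closed[OF ideal_chow_ideal] by simp

lemma chow_ideal_uminus: "p \<in> chow_ideal n \<Longrightarrow> - p \<in> chow_ideal n"
  using chow_ideal_mult[of p n "-1"] by simp

lemma chow_ideal_diff: "p \<in> chow_ideal n \<Longrightarrow> q \<in> chow_ideal n \<Longrightarrow> p - q \<in> chow_ideal n"
  using chow_ideal_add[of p n "- q"] by (simp add: chow_ideal_uminus)

lemma chow_ideal_sum: "(\<And>i. i \<in> A \<Longrightarrow> g i \<in> chow_ideal n) \<Longrightarrow> sum g A \<in> chow_ideal n"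
  by (induction A rule: infinite_finite_induct) (auto simp: chow_ideal_add)

lemma chow_ideal_incomparable:
  assumes "F \<in> nonempty_flats n" "G \<in> nonempty_flats n" "\<not> F \<subseteq> G" "\<not> G \<subseteq> F"
  shows "poly_var F * poly_var G \<in> chow_ideal n"
proof -
  have "poly_var F * poly_var G \<in> incomparable_products n"
    unfolding incomparable_products_def using assms by blast
  then show ?thesis
    unfolding chow_ideal_eq
    using cring.subset_genideal_add(1)[OF cring_flat_poly_ring generators_subset] by blast
qed

lemma chow_ideal_linear:
  assumes "i \<in> {1..n}"
  shows "(\<Sum>F \<in> {F \<in> nonempty_flats n. i \<in> F}. poly_var F) \<in> chow_ideal n" (is "?s \<in> _")
proof -
  have "?s \<in> linear_relations n"
    unfolding linear_relations_def using assms by blast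
  then show ?thesis
    unfolding chow_ideal_eq
    using cring.subset_genideal_add(2)[OF cring_flat_poly_ring generators_subset] by blast
qed

text \<open>Every statement about all elements of the ideal goes through this rule: it is applied to
  \<open>deformable n\<close> and to the preimage of the ideal under
  \<open>perm_poly \<sigma>\<close>, so that only the two kinds of generators have to be
  inspected.\<close>

lemma chow_ideal_minimal:
  assumes "ideal J (flat_poly_ring n)"
    and "\<And>F G. F \<in> nonempty_flats n \<Longrightarrow> G \<in> nonempty_flats n \<Longrightarrow> \<not> F \<subseteq> G \<Longrightarrow> \<not> G \<subseteq> F
      \<Longrightarrow> poly_var F * poly_var G \<in> J"
    and "\<And>i. i \<in> {1..n} \<Longrightarrow> (\<Sum>F \<in> {F \<in> nonempty_flats n. i \<in> F}. poly_var F) \<in> J"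
  shows "chow_ideal n \<subseteq> J"
  unfolding chow_ideal_eq
proof (rule cring.genideal_add_minimal[OF cring_flat_poly_ring assms(1)])
  show "incomparable_products n \<subseteq> J"
    unfolding incomparable_products_def using assms(2) by blast
  show "linear_relations n \<subseteq> J"
    unfolding linear_relations_def using assms(3) by blast
qed

text \<open>This is \<open>h\<^sub>G\<close> of the overview. For \<open>G = {i}\<close> it is the
  linear relation of \<open>i\<close>.\<close>

definition upper_sum :: "nat \<Rightarrow> nat set \<Rightarrow> flat_poly"
  where "upper_sum n G = (\<Sum>H \<in> {H \<in> nonempty_flats n. G \<subseteq> H}. poly_var H)"

lemma flat_polys_upper_sum [simp]: "upper_sum n G \<in> flat_polys n"
  unfolding upper_sum_def by (rule flat_polys_sum) simp

text \<open>The empty flat has no variable in the ring. The value 1 lets the gap below the smallest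
  member of a chain be treated like every other gap.\<close>

definition var_or_one :: "nat set \<Rightarrow> flat_poly"
  where "var_or_one F = (if F = {} then 1 else poly_var F)"

lemma flat_polys_var_or_one [simp]: "F \<subseteq> {1..n} \<Longrightarrow> var_or_one F \<in> flat_polys n"
  by (simp add: var_or_one_def nonempty_flats_def)

text \<open>Multiplying the linear relation of \<open>i\<close> by the variable of \<open>F\<close>
  kills every flat that contains \<open>i\<close> but not all of \<open>F\<close>: such a flat is
  incomparable to \<open>F\<close>, because \<open>i\<close> is not in \<open>F\<close>.\<close>

lemma var_upper_sum_insert:
  assumes "F \<subseteq> {1..n}" "i \<in> {1..n}" "i \<notin> F"
  shows "var_or_one F * upper_sum n (insert i F) \<in> chow_ideal n"
proof -
  let ?S = "{H \<in> nonempty_flats n. i \<in> H}" and ?T = "{H \<in> nonempty_flats n. insert i F \<subseteq> H}"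
  have "var_or_one F * (\<Sum>H\<in>?S. poly_var H) \<in> chow_ideal n"
    using assms by (intro chow_ideal_mult chow_ideal_linear) auto
  moreover have "var_or_one F * (\<Sum>H\<in>?S - ?T. poly_var H) \<in> chow_ideal n"
    unfolding sum_distrib_left
  proof (rule chow_ideal_sum)
    fix H assume H: "H \<in> ?S - ?T"
    then have "F \<noteq> {}" "F \<in> nonempty_flats n" "\<not> F \<subseteq> H" "\<not> H \<subseteq> F" using assms by (auto simp: nonempty_flats_def)
    then show "var_or_one F * poly_var H \<in> chow_ideal n"
      using H chow_ideal_incomparable[of F n H] by (simp add: var_or_one_def)
  qed
  moreover have "(\<Sum>H\<in>?S. poly_var H) = upper_sum n (insert i F) + (\<Sum>H\<in>?S - ?T. poly_var H)"
    unfolding upper_sum_def using sum.subset_diff[of ?T ?S poly_var] by (auto simp: add.commute)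
  ultimately show ?thesis
    using chow_ideal_diff by (fastforce simp: distrib_left)
qed

text \<open>Modulo the ideal, multiplying \<open>x * (h + v)\<close> by \<open>u\<close> and using
  \<open>u * v = 0\<close> gives \<open>x * h * u = 0\<close>. Hence, next to \<open>x * h\<close>,
  every factor \<open>h + u\<close> may be replaced by \<open>h\<close>, and the extra factor
  \<open>h\<close> is the price of this.\<close>

lemma chow_ideal_eliminate:
  assumes flat: "x \<in> flat_polys n" "h \<in> flat_polys n" "u \<in> flat_polys n" "v \<in> flat_polys n"
    and uv: "u * v \<in> chow_ideal n" and xv: "x * (h + v) \<in> chow_ideal n"
    and xu: "x * (h + u) ^ k \<in> chow_ideal n"
  shows "x * h ^ Suc k \<in> chow_ideal n"
proof -
  have "u * (x * (h + v)) - x * (u * v) \<in> chow_ideal n"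
    using uv xv flat by (blast intro: chow_ideal_diff chow_ideal_mult)
  then have xhu: "x * h * u \<in> chow_ideal n"
    by (simp add: algebra_simps)
  have "x * h * (h + u) ^ j - x * h * h ^ j \<in> chow_ideal n" for j
  proof (induction j)
    case (Suc j)
    have "(h + u) * (x * h * (h + u) ^ j - x * h * h ^ j) + h ^ j * (x * h * u) \<in> chow_ideal n"
      using Suc xhu flat
      by (blast intro: chow_ideal_add chow_ideal_mult flat_polys_add flat_polys_power)
    then show ?case by (simp add: algebra_simps)
  qed simp
  then have "h * (x * (h + u) ^ k) - (x * h * (h + u) ^ k - x * h * h ^ k) \<in> chow_ideal n"
    using flat xu by (blast intro: chow_ideal_diff chow_ideal_mult)
  then show ?thesis by (simp add: algebra_simps)
qed

text \<open>
  In the step from \<open>C\<close> to \<open>insert i C\<close>, write \<open>h\<close> for the upper sum of \<open>insert i C \<union> F\<close>. The upper sum of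
  \<open>C \<union> F\<close> is \<open>h + u\<close> and that of \<open>insert i F\<close> is \<open>h + v\<close>, where every flat occurring in \<open>u\<close> is
  incomparable to every flat occurring in \<open>v\<close>.
\<close>

lemma var_upper_sum_power:
  assumes "F \<subset> G" "G \<subseteq> {1..n}"
  shows "var_or_one F * upper_sum n G ^ (card G - card F) \<in> chow_ideal n"
proof -
  have F: "F \<subseteq> {1..n}" using assms by auto
  have fin: "finite G" "finite F"
    using finite_subset[OF assms(2)] finite_subset[OF F] by auto
  \<comment> \<open>The induction starts at singletons: for empty \<open>C\<close> the power is 1,
    and the claim would put \<open>var_or_one F\<close> itself into the ideal.\<close>
  have "finite C \<Longrightarrow> C \<noteq> {} \<Longrightarrow> C \<inter> F = {} \<Longrightarrow> C \<subseteq> {1..n}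
      \<Longrightarrow> var_or_one F * upper_sum n (C \<union> F) ^ card C \<in> chow_ideal n" for C
  proof (induction C rule: finite_ne_induct)
    case (singleton i)
    then show ?case using var_upper_sum_insert[of F n i] F by simp
  next
    case (insert i C)
    define U where "U = {H \<in> nonempty_flats n. C \<union> F \<subseteq> H \<and> i \<notin> H}"
    define V where "V = {H \<in> nonempty_flats n. insert i F \<subseteq> H \<and> \<not> C \<union> F \<subseteq> H}"
    have flats: "U \<subseteq> nonempty_flats n" "V \<subseteq> nonempty_flats n"
      by (auto simp: U_def V_def)
    have "upper_sum n (C \<union> F) = upper_sum n (insert i C \<union> F) + sum poly_var U"
      unfolding upper_sum_def
      by (subst sum.union_disjoint[symmetric]) (auto simp: U_def intro!: sum.cong)
    moreover have "upper_sum n (insert i F) = upper_sum n (insert i C \<union> F) + sum poly_var V"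
      unfolding upper_sum_def
      by (subst sum.union_disjoint[symmetric]) (auto simp: V_def intro!: sum.cong)
    moreover have "sum poly_var U * sum poly_var V \<in> chow_ideal n"
      unfolding sum_product
      by (intro chow_ideal_sum chow_ideal_incomparable) (auto simp: U_def V_def)
    moreover have "var_or_one F * upper_sum n (insert i F) \<in> chow_ideal n"
      using insert.prems insert.hyps F by (intro var_upper_sum_insert) auto
    moreover have "var_or_one F * upper_sum n (C \<union> F) ^ card C \<in> chow_ideal n"
      using insert.prems insert.IH by simp
    ultimately have "var_or_one F * upper_sum n (insert i C \<union> F) ^ Suc (card C) \<in> chow_ideal n"
      using F flats
      by (intro chow_ideal_eliminate[where u = "sum poly_var U" and v = "sum poly_var V"])
        (simp_all add: subset_iff)
    then show ?case
      using insert.hyps by simp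
  qed
  from this[of "G - F"] have "var_or_one F * upper_sum n (G - F \<union> F) ^ card (G - F) \<in> chow_ideal n"
    using assms fin by auto
  moreover have "G - F \<union> F = G" "card (G - F) = card G - card F"
    using assms fin by (auto simp: card_Diff_subset)
  ultimately show ?thesis by simp
qed

section \<open>Feichtner--Yuzvinsky exponents\<close>

text \<open>\<open>B\<close> is the lower end of the chain: \<open>{}\<close> gives the monomials of
  \<open>FY\<close>, and other bases arise when the smallest member is split off. The bound is
  demanded for all pairs \<open>G \<subset> F\<close>, so the chain need not be enumerated; the
  direct predecessor gives the strictest instance. Writing it as a sum avoids truncated
  subtraction.\<close>

definition fy_exponents :: "nat \<Rightarrow> nat set \<Rightarrow> (nat set \<Rightarrow>\<^sub>0 nat) set"
  where "fy_exponents n B = {m. Poly_Mapping.keys m \<subseteq> {F. B \<subset> F \<and> F \<subseteq> {1..n}} \<and>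
    (\<forall>F\<in>Poly_Mapping.keys m. \<forall>G\<in>Poly_Mapping.keys m. F \<subseteq> G \<or> G \<subseteq> F) \<and>
    (\<forall>F\<in>Poly_Mapping.keys m. \<forall>G\<in>insert B (Poly_Mapping.keys m). G \<subset> F
      \<longrightarrow> Poly_Mapping.lookup m F + card G < card F)}"

lemma fy_exponentsI:
  assumes "\<And>F. F \<in> Poly_Mapping.keys m \<Longrightarrow> B \<subset> F \<and> F \<subseteq> {1..n}"
    and "\<And>F G. F \<in> Poly_Mapping.keys m \<Longrightarrow> G \<in> Poly_Mapping.keys m \<Longrightarrow> F \<subseteq> G \<or> G \<subseteq> F"
    and "\<And>F G. F \<in> Poly_Mapping.keys m \<Longrightarrow> G \<in> insert B (Poly_Mapping.keys m) \<Longrightarrow> G \<subset> F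
      \<Longrightarrow> Poly_Mapping.lookup m F + card G < card F"
  shows "m \<in> fy_exponents n B"
  unfolding fy_exponents_def
proof (intro CollectI conjI ballI impI)
  show "Poly_Mapping.keys m \<subseteq> {F. B \<subset> F \<and> F \<subseteq> {1..n}}" using assms(1) by (simp add: subset_iff)
qed (simp_all add: assms(2,3))

lemma fy_exponentsD:
  assumes "m \<in> fy_exponents n B" "F \<in> Poly_Mapping.keys m"
  shows "B \<subset> F" "F \<subseteq> {1..n}"
    and "G \<in> Poly_Mapping.keys m \<Longrightarrow> F \<subseteq> G \<or> G \<subseteq> F"
    and "G \<in> insert B (Poly_Mapping.keys m) \<Longrightarrow> G \<subset> F \<Longrightarrow> Poly_Mapping.lookup m F + card G < card F"
  using assms unfolding fy_exponents_def by auto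

lemma lookup_minus_single:
  "Poly_Mapping.lookup (m - Poly_Mapping.single F (Poly_Mapping.lookup m F)) H
    = (if H = F then 0 else Poly_Mapping.lookup m H)" for m :: "'b \<Rightarrow>\<^sub>0 nat"
  by (simp add: lookup_minus lookup_single)

lemma keys_minus_single:
  "Poly_Mapping.keys (m - Poly_Mapping.single F (Poly_Mapping.lookup m F)) = Poly_Mapping.keys m - {F}"
  for m :: "'b \<Rightarrow>\<^sub>0 nat"
  by (auto simp: in_keys_iff lookup_minus_single split: if_splits)

lemma minus_single_add:
  "m - Poly_Mapping.single F (Poly_Mapping.lookup m F) + Poly_Mapping.single F (Poly_Mapping.lookup m F) = m"
  for m :: "'b \<Rightarrow>\<^sub>0 nat"
  by (rule poly_mapping_eqI) (simp add: lookup_add lookup_minus_single lookup_single)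

text \<open>For \<open>F\<close> the smallest member, the bounds of the higher members relative to
  \<open>F\<close> survive because \<open>F\<close> becomes the new base. This recursion drives the
  count.\<close>

lemma fy_exponents_decompose:
  assumes m: "m \<in> fy_exponents n B" and B: "B \<subseteq> {1..n}" and "m \<noteq> 0"
  obtains F a m' where "B \<subset> F" "F \<subseteq> {1..n}" "1 \<le> a" "a < card F - card B"
    "m' \<in> fy_exponents n F" "m = m' + Poly_Mapping.single F a"
proof -
  have "Poly_Mapping.keys m \<noteq> {}" using \<open>m \<noteq> 0\<close> by simp
  then obtain F where F: "F \<in> Poly_Mapping.keys m" and min: "\<And>G. G \<in> Poly_Mapping.keys m \<Longrightarrow> G \<subseteq> F \<Longrightarrow> F = G"
    using finite_has_minimal[of "Poly_Mapping.keys m"] by auto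
  define a where "a = Poly_Mapping.lookup m F"
  define m' where "m' = m - Poly_Mapping.single F a"
  have keys: "Poly_Mapping.keys m' = Poly_Mapping.keys m - {F}"
    unfolding m'_def a_def by (rule keys_minus_single)
  have lookup: "Poly_Mapping.lookup m' H = Poly_Mapping.lookup m H" if "H \<noteq> F" for H
    unfolding m'_def a_def using that by (simp add: lookup_minus_single)
  have above: "F \<subset> G" if "G \<in> Poly_Mapping.keys m'" for G
    using fy_exponentsD(3)[OF m F, of G] min[of G] that unfolding keys by auto
  have "m' \<in> fy_exponents n F"
  proof (rule fy_exponentsI)
    fix G assume G: "G \<in> Poly_Mapping.keys m'"
    then have Gm: "G \<in> Poly_Mapping.keys m" "G \<noteq> F" using keys by auto
    show "F \<subset> G \<and> G \<subseteq> {1..n}" using above[OF G] fy_exponentsD(2)[OF m Gm(1)] by simp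
    fix H
    show "G \<subseteq> H \<or> H \<subseteq> G" if "H \<in> Poly_Mapping.keys m'"
      using fy_exponentsD(3)[OF m Gm(1), of H] that keys by simp
    show "Poly_Mapping.lookup m' G + card H < card G" if "H \<in> insert F (Poly_Mapping.keys m')" "H \<subset> G"
      using fy_exponentsD(4)[OF m Gm(1), of H] that keys F lookup[OF Gm(2)] by auto
  qed
  moreover have "B \<subset> F" "F \<subseteq> {1..n}" "a + card B < card F"
    using fy_exponentsD[OF m F] by (auto simp: a_def)
  moreover have "1 \<le> a" using F by (simp add: a_def in_keys_iff)
  moreover have "m = m' + Poly_Mapping.single F a"
    unfolding m'_def a_def by (rule minus_single_add[symmetric])
  ultimately show ?thesis
    by (intro that[of F a m']) (simp_all add: less_diff_conv)
qed

lemma sum_Pow_card: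
  assumes "finite C"
  shows "(\<Sum>S\<in>Pow C. g (card S)) = (\<Sum>j\<le>card C. of_nat (card C choose j) * (g j :: 'a::comm_semiring_1))"
proof -
  have "(\<Sum>S\<in>Pow C. g (card S)) = (\<Sum>j\<le>card C. \<Sum>S\<in>{S \<in> Pow C. card S = j}. g (card S))"
    using assms by (intro sum.group[symmetric]) (auto intro: card_mono)
  also have "\<dots> = (\<Sum>j\<le>card C. of_nat (card {S \<in> Pow C. card S = j}) * g j)"
    by (intro sum.cong) auto
  also have "\<dots> = (\<Sum>j\<le>card C. of_nat (card C choose j) * g j)"
    using n_subsets[OF assms] by (simp add: Pow_def)
  finally show ?thesis .
qed

text \<open>With \<open>a j = fact N / fact j\<close> one has
  \<open>a j * (j - 1) + a j = a (j - 1)\<close> for \<open>j \<ge> 1\<close>, so the sum telescopes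
  from \<open>a N = 1\<close> down to \<open>a 0 = fact N\<close>. The summand at
  \<open>j = 0\<close> vanishes by truncation.\<close>

lemma sum_choose_fact: "(\<Sum>j\<le>N. (N choose j) * ((j - 1) * fact (N - j))) + 1 = (fact N :: nat)"
proof -
  define a :: "nat \<Rightarrow> nat" where "a j = (N choose j) * fact (N - j)" for j
  have a_fact: "a j * fact j = fact N" if "j \<le> N" for j
    using binomial_fact_lemma[OF that] by (simp add: a_def mult_ac)
  have a_Suc: "a j = Suc j * a (Suc j)" if "Suc j \<le> N" for j
    using a_fact[of j] a_fact[OF that] that by (simp add: algebra_simps) (metis add_mult_distrib2 fact_nonzero mult.assoc mult.commute mult_cancel_right mult_Suc_right)
  have "k \<le> N \<Longrightarrow> (\<Sum>j\<le>k. a j * (j - 1)) + a k = fact N" for k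
  proof (induction k)
    case 0
    then show ?case by (simp add: a_def)
  next
    case (Suc k)
    then show ?case using a_Suc[of k] by (simp add: algebra_simps)
  qed
  from this[of N] show ?thesis by (simp add: a_def mult_ac)
qed

text \<open>A nonzero exponent is determined by its smallest member \<open>F\<close>, one of
  \<open>card F - card B - 1\<close> values there, and an exponent over the base \<open>F\<close>.
  Grouping the sets \<open>F\<close> by the size of \<open>F - B\<close> turns this into the
  recursion solved by \<open>sum_choose_fact\<close>.\<close>

lemma fy_exponents_bound:
  "B \<subseteq> {1..n} \<Longrightarrow> finite (fy_exponents n B) \<and> card (fy_exponents n B) \<le> fact (n - card B)"
proof (induction "n - card B" arbitrary: B rule: less_induct)
  case less
  define U where "U = {F. B \<subset> F \<and> F \<subseteq> {1..n}}"
  define E where "E F = (\<Union>a\<in>{1..<card F - card B}. (\<lambda>m. m + Poly_Mapping.single F a) ` fy_exponents n F)" for F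
  have fin_U: "finite U" unfolding U_def by simp
  have fin_B: "finite B" using finite_subset[OF less.prems] by simp
  have card_lt: "card B < card F" "card F \<le> n" if "F \<in> U" for F
  proof -
    have "finite F" using that finite_subset[of F "{1..n}"] by (auto simp: U_def)
    then show "card B < card F" using that by (auto simp: U_def intro: psubset_card_mono)
    show "card F \<le> n" using that card_mono[of "{1..n}" F] by (auto simp: U_def)
  qed
  have IH: "finite (fy_exponents n F)" "card (fy_exponents n F) \<le> fact (n - card F)" if "F \<in> U" for F
    using less.hyps[of F] card_lt[OF that] that by (auto simp: U_def)
  have fin_E: "finite (E F)" if "F \<in> U" for F
    unfolding E_def using IH[OF that] by auto
  have card_E: "card (E F) \<le> (card F - card B - 1) * fact (n - card F)" if "F \<in> U" for F
  proof -
    have "card (E F) \<le> (\<Sum>a\<in>{1..<card F - card B}. card ((\<lambda>m. m + Poly_Mapping.single F a) ` fy_exponents n F))"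
      unfolding E_def by (rule card_UN_le) simp
    also have "\<dots> \<le> (\<Sum>a\<in>{1..<card F - card B}. fact (n - card F))"
      using IH[OF that] by (intro sum_mono) (meson card_image_le order_trans)
    finally show ?thesis by simp
  qed
  have sub: "fy_exponents n B \<subseteq> insert 0 (\<Union>F\<in>U. E F)"
  proof
    fix m assume m: "m \<in> fy_exponents n B"
    show "m \<in> insert 0 (\<Union>F\<in>U. E F)"
    proof (cases "m = 0")
      case False
      then obtain F a m' where "B \<subset> F" "F \<subseteq> {1..n}" and a: "1 \<le> a" "a < card F - card B"
        and m': "m' \<in> fy_exponents n F" "m = m' + Poly_Mapping.single F a"
        using fy_exponents_decompose[OF m less.prems] by blast
      then have "F \<in> U" by (simp add: U_def)
      moreover have "m \<in> E F"
        unfolding E_def using a m' by (intro UN_I[of a] image_eqI[of _ _ m']) simp_all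
      ultimately show ?thesis by (intro insertI2 UN_I)
    qed simp
  qed
  have fin: "finite (insert 0 (\<Union>F\<in>U. E F))" using fin_U fin_E by auto
  define C where "C = {1..n} - B"
  have card_C: "card C = n - card B"
    unfolding C_def using less.prems fin_B by (simp add: card_Diff_subset)
  have "card (fy_exponents n B) \<le> card (insert 0 (\<Union>F\<in>U. E F))"
    by (rule card_mono[OF fin sub])
  also have "\<dots> \<le> card (\<Union>F\<in>U. E F) + 1"
    using fin_U fin_E by (simp add: card_insert_if)
  also have "card (\<Union>F\<in>U. E F) \<le> (\<Sum>F\<in>U. card (E F))"
    by (rule card_UN_le[OF fin_U])
  also have "\<dots> \<le> (\<Sum>F\<in>U. (card F - card B - 1) * fact (n - card F))"
    by (rule sum_mono) (rule card_E)
  also have "\<dots> = (\<Sum>S\<in>Pow C - {{}}. (card S - 1) * fact (card C - card S))"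
  proof (rule sum.reindex_bij_witness[where i = "\<lambda>S. B \<union> S" and j = "\<lambda>F. F - B"])
    fix F assume "F \<in> U"
    then show "(card (F - B) - 1) * fact (card C - card (F - B)) = (card F - card B - 1) * fact (n - card F)"
      using fin_B card_lt[of F] unfolding U_def card_C by (subst (1 2) card_Diff_subset) auto
  qed (use less.prems in \<open>auto simp: U_def C_def\<close>)
  \<comment> \<open>The summand added for the empty \<open>S\<close> is 0, because
    \<open>0 - 1 = 0\<close> for natural numbers.\<close>
  also have "\<dots> \<le> (\<Sum>S\<in>Pow C. (card S - 1) * fact (card C - card S))"
    unfolding C_def by (rule sum_mono2) auto
  also have "\<dots> = (\<Sum>j\<le>card C. (card C choose j) * ((j - 1) * fact (card C - j)))"
    using sum_Pow_card[of C "\<lambda>j. (j - 1) * fact (card C - j)"] by (simp add: C_def)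
  finally show ?case
    using sum_choose_fact[of "card C"] finite_subset[OF sub fin] unfolding card_C by simp
qed

section \<open>Agreement of the exponents with the chains that define FY\<close>

definition fy_chain :: "nat \<Rightarrow> nat \<Rightarrow> (nat \<Rightarrow> nat set) \<Rightarrow> (nat \<Rightarrow> nat) \<Rightarrow> bool"
  where "fy_chain n l F a \<longleftrightarrow> F 0 = {} \<and> F l \<subseteq> {1..n} \<and>
    (\<forall>i \<in> {1..l}. F (i - 1) \<subset> F i \<and> 1 \<le> a i \<and> a i \<le> card (F i) - card (F (i - 1)) - 1)"

lemma FY_iff:
  "p \<in> FY n \<longleftrightarrow> (\<exists>l F a. p = (\<Prod>i = 1..l. poly_var (F i) ^ a i) \<and> l \<le> n \<and> fy_chain n l F a)"
  unfolding FY_def fy_chain_def by (rule mem_Collect_eq)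

lemma FY_subset: "FY n \<subseteq> monomial ` fy_exponents n {}"
proof
  fix p assume "p \<in> FY n"
  then obtain l F a where p: "p = (\<Prod>i = 1..l. poly_var (F i) ^ a i)" and chain: "fy_chain n l F a"
    unfolding FY_iff by blast
  have F0: "F 0 = {}" and Fl: "F l \<subseteq> {1..n}"
    and step0: "\<forall>i \<in> {1..l}. F (i - 1) \<subset> F i \<and> 1 \<le> a i \<and> a i \<le> card (F i) - card (F (i - 1)) - 1"
    using chain by (simp_all add: fy_chain_def)
  note step = bspec[OF step0]
  have mono: "F i \<subseteq> F j" if "i \<le> j" "j \<le> l" for i j
    using that(1,2)
  proof (induction j rule: dec_induct)
    case (step j)
    then show ?case using step0[rule_format, of "Suc j"] by auto
  qed simp
  have strict: "F i \<subset> F j" if "i < j" "j \<le> l" for i j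
    using mono[of "Suc i" j] step[of "Suc i"] that by auto
  have inj: "F i = F j \<longleftrightarrow> i = j" if "i \<le> l" "j \<le> l" for i j
    using strict[of i j] strict[of j i] that by (cases i j rule: linorder_cases) auto
  have sub: "F i \<subseteq> {1..n}" if "i \<le> l" for i
    using mono[of i l] Fl that by auto
  define m where "m = (\<Sum>i = 1..l. Poly_Mapping.single (F i) (a i))"
  have p_m: "p = monomial m"
    unfolding p m_def by (simp add: eval_monom_sum flip: eval_monom_poly_var)
  have lookup_m: "Poly_Mapping.lookup m (F i) = a i" if "i \<in> {1..l}" for i
  proof -
    have "Poly_Mapping.lookup m (F i) = (\<Sum>j\<in>{1..l}. if i = j then a j else 0)"
      unfolding m_def lookup_sum by (intro sum.cong) (use that inj in \<open>auto simp: lookup_single when_def\<close>)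
    then show ?thesis using that by simp
  qed
  have keys_m: "Poly_Mapping.keys m \<subseteq> F ` {1..l}"
    unfolding m_def by (rule order_trans[OF keys_sum]) auto
  have "m \<in> fy_exponents n {}"
  proof (rule fy_exponentsI)
    fix G assume "G \<in> Poly_Mapping.keys m"
    then obtain i where i: "i \<in> {1..l}" "G = F i" using keys_m by blast
    show "{} \<subset> G \<and> G \<subseteq> {1..n}" using step[OF i(1)] sub[of i] i by auto
    fix H
    have ex: "\<exists>j\<le>l. H = F j" if "H \<in> insert {} (Poly_Mapping.keys m)"
      using that keys_m F0 by (auto dest!: subsetD)
    show "G \<subseteq> H \<or> H \<subseteq> G" if "H \<in> Poly_Mapping.keys m"
      using ex that mono[of i] mono[of _ i] i by (metis insertCI atLeastAtMost_iff nle_le)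
    assume H: "H \<in> insert {} (Poly_Mapping.keys m)" "H \<subset> G"
    obtain j where j: "j \<le> l" "H = F j" using ex H(1) by blast
    \<comment> \<open>Any smaller member sits at position \<open>i - 1\<close> or below, so the
      bound relative to the direct predecessor implies all the others.\<close>
    have "j \<le> i - 1" using H(2) mono[of i j] j i by (cases "j < i") auto
    moreover have "i - 1 \<le> l" using i by auto
    ultimately have "H \<subseteq> F (i - 1)" using mono[of j "i - 1"] j by simp
    moreover have "finite (F i)" using sub[of i] i finite_subset[of "F i"] by auto
    moreover have "F (i - 1) \<subset> F i" using step i by blast
    ultimately have "card H \<le> card (F (i - 1))" "card (F (i - 1)) < card (F i)"
      by (auto intro: card_mono psubset_card_mono dest: finite_subset)
    then show "Poly_Mapping.lookup m G + card H < card G"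
      using step[OF i(1)] lookup_m[OF i(1)] unfolding i(2) by linarith
  qed
  then show "p \<in> monomial ` fy_exponents n {}" using p_m by blast
qed

text \<open>Here the largest member is removed, unlike in \<open>fy_exponents_decompose\<close>:
  appending on top leaves \<open>F 0 = {}\<close> and the indices of the shorter chain untouched.
  The last two conclusions identify the top of the chain, which the induction needs in order to
  append.\<close>

lemma fy_exponents_chain:
  "m \<in> fy_exponents n {} \<Longrightarrow> card (Poly_Mapping.keys m) = l \<Longrightarrow>
    \<exists>F a. monomial m = (\<Prod>i = 1..l. poly_var (F i) ^ a i) \<and> fy_chain n l F a \<and>
      F l \<in> insert {} (Poly_Mapping.keys m) \<and> (\<forall>G\<in>Poly_Mapping.keys m. G \<subseteq> F l)"
proof (induction l arbitrary: m)
  case 0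
  then have "m = 0" by simp
  then show ?case by (intro exI[of _ "\<lambda>_. {}"]) (simp add: fy_chain_def)
next
  case (Suc l)
  then have "Poly_Mapping.keys m \<noteq> {}" by auto
  then obtain T where T: "T \<in> Poly_Mapping.keys m" and max: "\<And>G. G \<in> Poly_Mapping.keys m \<Longrightarrow> T \<subseteq> G \<Longrightarrow> T = G"
    using finite_has_maximal[of "Poly_Mapping.keys m"] by auto
  define m' where "m' = m - Poly_Mapping.single T (Poly_Mapping.lookup m T)"
  have keys: "Poly_Mapping.keys m' = Poly_Mapping.keys m - {T}"
    unfolding m'_def by (rule keys_minus_single)
  have lookup: "Poly_Mapping.lookup m' H = Poly_Mapping.lookup m H" if "H \<noteq> T" for H
    unfolding m'_def using that by (simp add: lookup_minus_single)
  have below: "G \<subseteq> T" if "G \<in> Poly_Mapping.keys m" for G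
    using fy_exponentsD(3)[OF Suc.prems(1) T that] max[OF that] by auto
  have "m' \<in> fy_exponents n {}"
  proof (rule fy_exponentsI)
    fix G assume G: "G \<in> Poly_Mapping.keys m'"
    then have Gm: "G \<in> Poly_Mapping.keys m" "G \<noteq> T" using keys by auto
    show "{} \<subset> G \<and> G \<subseteq> {1..n}" using fy_exponentsD(1,2)[OF Suc.prems(1) Gm(1)] by simp
    fix H
    show "G \<subseteq> H \<or> H \<subseteq> G" if "H \<in> Poly_Mapping.keys m'"
      using fy_exponentsD(3)[OF Suc.prems(1) Gm(1), of H] that keys by simp
    show "Poly_Mapping.lookup m' G + card H < card G" if "H \<in> insert {} (Poly_Mapping.keys m')" "H \<subset> G"
      using fy_exponentsD(4)[OF Suc.prems(1) Gm(1), of H] that keys lookup[OF Gm(2)] by auto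
  qed
  moreover have "card (Poly_Mapping.keys m') = l"
    using Suc.prems(2) T by (simp add: keys)
  ultimately obtain F a where prod: "monomial m' = (\<Prod>i = 1..l. poly_var (F i) ^ a i)" and chain: "fy_chain n l F a"
    and Fl: "F l \<in> insert {} (Poly_Mapping.keys m')" "\<forall>G\<in>Poly_Mapping.keys m'. G \<subseteq> F l"
    using Suc.IH[of m'] by blast
  have F0: "F 0 = {}"
    and step: "\<forall>i \<in> {1..l}. F (i - 1) \<subset> F i \<and> 1 \<le> a i \<and> a i \<le> card (F i) - card (F (i - 1)) - 1"
    using chain by (simp_all add: fy_chain_def)
  define F' where "F' = F(Suc l := T)"
  define a' where "a' = a(Suc l := Poly_Mapping.lookup m T)"
  have T_ne: "{} \<subset> T" "T \<subseteq> {1..n}" using fy_exponentsD(1,2)[OF Suc.prems(1) T] .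
  have FlT: "F l \<subset> T" using Fl(1) below keys T_ne by auto
  have "monomial m = monomial m' * poly_var T ^ Poly_Mapping.lookup m T"
    using minus_single_add[of m T] by (simp add: m'_def flip: monomial_single monomial_add)
  also have "\<dots> = (\<Prod>i = 1..l. poly_var (F' i) ^ a' i) * poly_var (F' (Suc l)) ^ a' (Suc l)"
    unfolding prod by (intro arg_cong2[where f = "(*)"] prod.cong) (auto simp: F'_def a'_def)
  finally have "monomial m = (\<Prod>i = 1..Suc l. poly_var (F' i) ^ a' i)" by simp
  moreover have "Poly_Mapping.lookup m T + card (F l) < card T"
    using fy_exponentsD(4)[OF Suc.prems(1) T, of "F l"] Fl(1) keys FlT by auto
  moreover have "Poly_Mapping.lookup m T \<ge> 1"
    using T by (simp add: in_keys_iff Suc_le_eq)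
  ultimately have "monomial m = (\<Prod>i = 1..Suc l. poly_var (F' i) ^ a' i)" "F' 0 = {}" "F' (Suc l) = T"
    "F' (Suc l - 1) \<subset> F' (Suc l) \<and> 1 \<le> a' (Suc l) \<and> a' (Suc l) \<le> card (F' (Suc l)) - card (F' (Suc l - 1)) - 1"
    using F0 FlT by (auto simp: F'_def a'_def)
  moreover have "F' (i - 1) \<subset> F' i \<and> 1 \<le> a' i \<and> a' i \<le> card (F' i) - card (F' (i - 1)) - 1" if "i \<in> {1..l}" for i
    using step that by (auto simp: F'_def a'_def)
  ultimately have "monomial m = (\<Prod>i = 1..Suc l. poly_var (F' i) ^ a' i)" "fy_chain n (Suc l) F' a'" "F' (Suc l) = T"
    using T_ne unfolding fy_chain_def by (auto simp: atLeastAtMostSuc_conv)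
  then show ?case
    using T below by (intro exI[of _ F'] exI[of _ a']) auto
qed

lemma monomial_in_FY:
  assumes "m \<in> fy_exponents n {}"
  shows "monomial m \<in> FY n"
proof -
  let ?l = "card (Poly_Mapping.keys m)"
  obtain F a where prod: "monomial m = (\<Prod>i = 1..?l. poly_var (F i) ^ a i)" and chain: "fy_chain n ?l F a"
    using fy_exponents_chain[OF assms refl] by blast
  have Fl: "F ?l \<subseteq> {1..n}"
    and step: "\<forall>i \<in> {1..?l}. F (i - 1) \<subset> F i \<and> 1 \<le> a i \<and> a i \<le> card (F i) - card (F (i - 1)) - 1"
    using chain by (simp_all add: fy_chain_def)
  \<comment> \<open>A strict chain gains at least one element per step; at the top this yields the
    length bound that \<open>FY\<close> asks for.\<close>
  have "i \<le> ?l \<Longrightarrow> i \<le> card (F i)" for i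
  proof (induction i)
    case (Suc i)
    then show ?case using step[rule_format, of "Suc i"] by simp linarith
  qed simp
  then have "?l \<le> n" using card_mono[OF _ Fl] by fastforce
  then show ?thesis
    unfolding FY_iff using prod chain by blast
qed

lemma FY_eq: "FY n = monomial ` fy_exponents n {}"
  using FY_subset monomial_in_FY by blast

lemma FY_deg_eq: "FY_deg n k = monomial ` {m \<in> fy_exponents n {}. total_degree m = k}"
  by (auto simp: FY_deg_def FY_eq)

section \<open>Straightening\<close>

definition fy_combination :: "nat \<Rightarrow> nat \<Rightarrow> ((nat set \<Rightarrow>\<^sub>0 nat) \<Rightarrow> rat) \<Rightarrow> flat_poly"
  where "fy_combination n k c = (\<Sum>m \<in> {m \<in> fy_exponents n {}. total_degree m = k}. poly_const (c m) * monomial m)"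

text \<open>The degree is carried along so that one straightening argument yields spanning for each
  graded component as well as for the whole ring.\<close>

definition fy_reducible :: "nat \<Rightarrow> nat \<Rightarrow> flat_poly \<Rightarrow> bool"
  where "fy_reducible n k p \<longleftrightarrow> (\<exists>c. p - fy_combination n k c \<in> chow_ideal n)"

lemma finite_fy_exponents [simp]: "finite (fy_exponents n {})"
  using fy_exponents_bound[of "{}" n] by simp

lemma fy_reducible_cong: "p - q \<in> chow_ideal n \<Longrightarrow> fy_reducible n k q \<Longrightarrow> fy_reducible n k p"
  using chow_ideal_add[of "p - q" n "q - fy_combination n k c" for c] by (auto simp: fy_reducible_def)

lemma fy_reducible_0 [simp]: "fy_reducible n k 0"
  unfolding fy_reducible_def by (intro exI[of _ "\<lambda>_. 0"]) (simp add: fy_combination_def)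

lemma fy_reducible_ideal: "p \<in> chow_ideal n \<Longrightarrow> fy_reducible n k p"
  by (rule fy_reducible_cong[of _ 0]) simp_all

lemma fy_reducible_add:
  assumes "fy_reducible n k p" "fy_reducible n k q"
  shows "fy_reducible n k (p + q)"
proof -
  obtain c d where "p - fy_combination n k c \<in> chow_ideal n" "q - fy_combination n k d \<in> chow_ideal n"
    using assms unfolding fy_reducible_def by blast
  moreover have "fy_combination n k (\<lambda>m. c m + d m) = fy_combination n k c + fy_combination n k d"
    by (simp add: fy_combination_def poly_const.hom_add distrib_right sum.distrib)
  ultimately have "p + q - fy_combination n k (\<lambda>m. c m + d m) \<in> chow_ideal n"
    using chow_ideal_add by (fastforce simp: algebra_simps)
  then show ?thesis unfolding fy_reducible_def by blast
qed

lemma fy_reducible_scale: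
  assumes "fy_reducible n k p"
  shows "fy_reducible n k (poly_const a * p)"
proof -
  obtain c where "p - fy_combination n k c \<in> chow_ideal n"
    using assms unfolding fy_reducible_def by blast
  then have "poly_const a * (p - fy_combination n k c) \<in> chow_ideal n"
    by (rule chow_ideal_mult) simp
  moreover have "fy_combination n k (\<lambda>m. a * c m) = poly_const a * fy_combination n k c"
    by (simp add: fy_combination_def poly_const.hom_mult sum_distrib_left mult.assoc)
  ultimately show ?thesis
    unfolding fy_reducible_def by (intro exI[of _ "\<lambda>m. a * c m"]) (simp add: right_diff_distrib)
qed

lemma fy_reducible_sum: "(\<And>i. i \<in> A \<Longrightarrow> fy_reducible n k (g i)) \<Longrightarrow> fy_reducible n k (sum g A)"
  by (induction A rule: infinite_finite_induct) (auto simp: fy_reducible_add)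

lemma fy_reducible_keys:
  assumes "\<And>m. m \<in> Poly_Mapping.keys p \<Longrightarrow> fy_reducible n k (monomial m)"
  shows "fy_reducible n k p"
  by (subst flat_poly_eq_sum) (intro fy_reducible_sum fy_reducible_scale assms)

lemma fy_reducible_fy:
  assumes "m \<in> fy_exponents n {}" "total_degree m = k"
  shows "fy_reducible n k (monomial m)"
proof -
  have "fy_combination n k (\<lambda>m'. if m' = m then 1 else 0)
      = (\<Sum>m'\<in>{m \<in> fy_exponents n {}. total_degree m = k}. if m' = m then monomial m else 0)"
    unfolding fy_combination_def by (rule sum.cong) auto
  also have "\<dots> = monomial m"
    using assms by simp
  finally show ?thesis
    unfolding fy_reducible_def by (intro exI[of _ "\<lambda>m'. if m' = m then 1 else 0"]) simp
qed

lemma keys_add_nat: "Poly_Mapping.keys (m + m') = Poly_Mapping.keys m \<union> Poly_Mapping.keys m'"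
  for m m' :: "'b \<Rightarrow>\<^sub>0 nat"
  by (auto simp: in_keys_iff lookup_add)

section \<open>The size that straightening increases\<close>

definition total_size :: "(nat set \<Rightarrow>\<^sub>0 nat) \<Rightarrow> nat"
  where "total_size m = (\<Sum>F \<in> Poly_Mapping.keys m. Poly_Mapping.lookup m F * card F)"

lemma total_size_superset:
  "finite A \<Longrightarrow> Poly_Mapping.keys m \<subseteq> A \<Longrightarrow> total_size m = (\<Sum>F\<in>A. Poly_Mapping.lookup m F * card F)"
  unfolding total_size_def by (rule sum.mono_neutral_left) (auto simp: in_keys_iff)

lemma total_size_single [simp]: "total_size (Poly_Mapping.single F k) = k * card F"
  by (simp add: total_size_def)

lemma total_size_add: "total_size (m + m') = total_size m + total_size m'"
  using keys_add[of m m']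
  by (simp add: total_size_superset[of "Poly_Mapping.keys m \<union> Poly_Mapping.keys m'"] lookup_add
      distrib_right sum.distrib)

text \<open>In a fixed degree the size is bounded, so rewriting that strictly raises it
  terminates.\<close>

lemma total_size_le:
  assumes "Poly_Mapping.keys m \<subseteq> nonempty_flats n"
  shows "total_size m \<le> n * total_degree m"
proof -
  have "card F \<le> n" if "F \<in> Poly_Mapping.keys m" for F
    using assms that card_mono[of "{1..n}" F] by (auto simp: nonempty_flats_def)
  then show ?thesis
    unfolding total_size_def total_degree_def sum_distrib_left
    by (intro sum_mono) (simp add: mult.commute)
qed

definition homogeneous_size_ge :: "nat \<Rightarrow> nat \<Rightarrow> nat \<Rightarrow> flat_poly \<Rightarrow> bool"
  where "homogeneous_size_ge n k s p \<longleftrightarrow> (\<forall>m\<in>Poly_Mapping.keys p.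
    Poly_Mapping.keys m \<subseteq> nonempty_flats n \<and> total_degree m = k \<and> s \<le> total_size m)"

lemma homogeneous_size_ge_add:
  "homogeneous_size_ge n k s p \<Longrightarrow> homogeneous_size_ge n k s q \<Longrightarrow> homogeneous_size_ge n k s (p + q)"
  using keys_add[of p q] by (auto simp: homogeneous_size_ge_def)

lemma homogeneous_size_ge_0 [simp]: "homogeneous_size_ge n k s 0"
  by (simp add: homogeneous_size_ge_def)

lemma homogeneous_size_ge_sum:
  "(\<And>i. i \<in> A \<Longrightarrow> homogeneous_size_ge n k s (g i)) \<Longrightarrow> homogeneous_size_ge n k s (sum g A)"
  by (induction A rule: infinite_finite_induct) (auto simp: homogeneous_size_ge_add)

lemma homogeneous_size_ge_mult:
  assumes p: "homogeneous_size_ge n k s p" and q: "homogeneous_size_ge n k' s' q"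
  shows "homogeneous_size_ge n (k + k') (s + s') (p * q)"
  unfolding homogeneous_size_ge_def
proof
  fix m assume "m \<in> Poly_Mapping.keys (p * q)"
  then obtain a b where m: "m = a + b" "a \<in> Poly_Mapping.keys p" "b \<in> Poly_Mapping.keys q"
    using keys_mult by blast
  then have "Poly_Mapping.keys a \<subseteq> nonempty_flats n \<and> total_degree a = k \<and> s \<le> total_size a"
    "Poly_Mapping.keys b \<subseteq> nonempty_flats n \<and> total_degree b = k' \<and> s' \<le> total_size b"
    using p q unfolding homogeneous_size_ge_def by auto
  then show "Poly_Mapping.keys m \<subseteq> nonempty_flats n \<and> total_degree m = k + k' \<and> s + s' \<le> total_size m"
    using keys_add[of a b] by (auto simp: m(1) total_degree_add total_size_add)
qed

lemma homogeneous_size_ge_mono: "homogeneous_size_ge n k s p \<Longrightarrow> s' \<le> s \<Longrightarrow> homogeneous_size_ge n k s' p"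
  by (force simp: homogeneous_size_ge_def)

lemma homogeneous_size_ge_var:
  "F \<in> nonempty_flats n \<Longrightarrow> homogeneous_size_ge n 1 (card F) (poly_var F)"
  by (simp add: homogeneous_size_ge_def poly_var_def)

lemma homogeneous_size_ge_var_power:
  "F \<in> nonempty_flats n \<Longrightarrow> homogeneous_size_ge n d (d * card F) (poly_var F ^ d)"
  unfolding monomial_single[symmetric] by (simp add: homogeneous_size_ge_def monomial_def)

text \<open>Write \<open>h = x + y\<close>, where \<open>x\<close> is the variable of
  \<open>F\<close> and \<open>y\<close> collects the flats strictly above \<open>F\<close>. Passing
  to the next power, the difference becomes \<open>h * (h ^ d - x ^ d) + y * x ^ d\<close>, and each
  summand has a factor of excess size.\<close>

lemma upper_sum_power_leading:
  assumes F: "F \<in> nonempty_flats n"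
  shows "homogeneous_size_ge n d (Suc (d * card F)) (upper_sum n F ^ d - poly_var F ^ d)"
proof (induction d)
  case (Suc d)
  define y where "y = (\<Sum>H\<in>{H \<in> nonempty_flats n. F \<subset> H}. poly_var H)"
  have split: "upper_sum n F = poly_var F + y"
    unfolding upper_sum_def y_def using F
    by (subst sum.remove[of _ F]) (auto intro!: sum.cong)
  have "Suc (card F) \<le> card H" if "H \<in> nonempty_flats n" "F \<subset> H" for H
    using that finite_subset[of H "{1..n}"] by (auto simp: nonempty_flats_def Suc_le_eq intro: psubset_card_mono)
  then have y: "homogeneous_size_ge n 1 (Suc (card F)) y"
    unfolding y_def
    by (intro homogeneous_size_ge_sum homogeneous_size_ge_mono[OF homogeneous_size_ge_var]) auto
  have "homogeneous_size_ge n 1 (card F) (upper_sum n F)"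
    unfolding split using F y by (intro homogeneous_size_ge_add homogeneous_size_ge_var) (auto elim: homogeneous_size_ge_mono)
  from homogeneous_size_ge_mult[OF this Suc]
  have "homogeneous_size_ge n (Suc d) (Suc (Suc d * card F)) (upper_sum n F * (upper_sum n F ^ d - poly_var F ^ d))"
    by simp
  moreover have "homogeneous_size_ge n (Suc d) (Suc (Suc d * card F)) (y * poly_var F ^ d)"
    using homogeneous_size_ge_mult[OF y homogeneous_size_ge_var_power[OF F, of d]] by simp
  moreover have "upper_sum n F ^ Suc d - poly_var F ^ Suc d
      = upper_sum n F * (upper_sum n F ^ d - poly_var F ^ d) + y * poly_var F ^ d"
    by (simp add: split algebra_simps)
  ultimately show ?case by (simp only: homogeneous_size_ge_add)
qed simp

text \<open>
  Both rewrite rules keep the degree, and the second one replaces a monomial by monomials in larger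
  flats, so it strictly increases \<^const>\<open>total_size\<close>.
\<close>

lemma fy_reducible_monomial:
  "Poly_Mapping.keys m \<subseteq> nonempty_flats n \<Longrightarrow> fy_reducible n (total_degree m) (monomial m)"
proof (induction "n * total_degree m - total_size m" arbitrary: m rule: less_induct)
  case less
  \<comment> \<open>A monomial outside \<open>fy_exponents\<close> violates comparability or one of
    the gap bounds; \<open>G = {}\<close> stands for the gap below the smallest member.\<close>
  consider "m \<in> fy_exponents n {}"
    | F G where "F \<in> Poly_Mapping.keys m" "G \<in> Poly_Mapping.keys m" "\<not> F \<subseteq> G" "\<not> G \<subseteq> F"
    | F G where "F \<in> Poly_Mapping.keys m" "G \<in> insert {} (Poly_Mapping.keys m)" "G \<subset> F"
        "card F \<le> Poly_Mapping.lookup m F + card G"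
  proof (rule ccontr)
    note cases = that
    assume no: "\<not> thesis"
    have "m \<in> fy_exponents n {}"
    proof (rule fy_exponentsI)
      fix F assume F: "F \<in> Poly_Mapping.keys m"
      show "{} \<subset> F \<and> F \<subseteq> {1..n}" using less.prems F by (auto simp: nonempty_flats_def)
      fix G
      show "F \<subseteq> G \<or> G \<subseteq> F" if "G \<in> Poly_Mapping.keys m"
        using cases(2)[of F G] F that no by blast
      show "Poly_Mapping.lookup m F + card G < card F" if "G \<in> insert {} (Poly_Mapping.keys m)" "G \<subset> F"
        using cases(3)[of F G] F that no by (meson not_le)
    qed
    then show False using cases(1) no by blast
  qed
  then show ?case
  proof cases
    case 1
    then show ?thesis by (rule fy_reducible_fy) simp
  next
    case (2 F G)
    define m0 where "m0 = m - (Poly_Mapping.single F 1 + Poly_Mapping.single G 1)"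
    have "m = m0 + (Poly_Mapping.single F 1 + Poly_Mapping.single G 1)"
      using 2 by (intro poly_mapping_eqI) (auto simp: m0_def lookup_add lookup_minus lookup_single when_def in_keys_iff)
    then have "monomial m = monomial m0 * (poly_var F * poly_var G)"
      by (simp add: monomial_add monomial_single)
    moreover have "Poly_Mapping.keys m0 \<subseteq> Poly_Mapping.keys m"
      by (auto simp: m0_def in_keys_iff lookup_minus)
    then have "monomial m0 \<in> flat_polys n" using less.prems by simp
    moreover have "poly_var F * poly_var G \<in> chow_ideal n"
      using 2 less.prems by (intro chow_ideal_incomparable) auto
    ultimately show ?thesis
      by (simp add: fy_reducible_ideal chow_ideal_mult)
  next
    case (3 F G)
    define d where "d = card F - card G"
    \<comment> \<open>Splits off one variable of \<open>G\<close>, or nothing for empty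
      \<open>G\<close>, to match \<open>var_or_one G\<close>.\<close>
    define g where "g = (if G = {} then 0 else Poly_Mapping.single G (1::nat))"
    define m0 where "m0 = m - (Poly_Mapping.single F d + g)"
    have F: "F \<in> nonempty_flats n" using 3 less.prems by blast
    then have "F \<subseteq> {1..n}" by (simp add: nonempty_flats_def)
    have "d \<le> Poly_Mapping.lookup m F" "F \<noteq> G" using 3 by (auto simp: d_def)
    moreover have "G = {} \<or> 1 \<le> Poly_Mapping.lookup m G" using 3 by (auto simp: in_keys_iff Suc_le_eq)
    ultimately have "Poly_Mapping.lookup m H = Poly_Mapping.lookup ((m0 + g) + Poly_Mapping.single F d) H" for H
      by (auto simp: m0_def g_def lookup_add lookup_minus lookup_single when_def)
    then have m: "m = (m0 + g) + Poly_Mapping.single F d" by (rule poly_mapping_eqI)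
    have "Poly_Mapping.keys m = Poly_Mapping.keys m0 \<union> Poly_Mapping.keys g \<union> Poly_Mapping.keys (Poly_Mapping.single F d)"
      by (subst m) (simp only: keys_add_nat)
    then have keys0: "Poly_Mapping.keys (m0 + g) \<subseteq> nonempty_flats n"
      and keys_m0: "Poly_Mapping.keys m0 \<subseteq> nonempty_flats n"
      using less.prems by (auto simp: keys_add_nat)
    have mon_g: "monomial g = var_or_one G"
      by (simp add: g_def var_or_one_def monomial_single)
    \<comment> \<open>\<open>monomial m + q\<close> is a multiple of the vanishing product
      \<open>var_or_one G * upper_sum n F ^ d\<close>, so \<open>monomial m\<close> is congruent to
      \<open>- q\<close>, all of whose monomials have larger size.\<close>
    define q where "q = monomial (m0 + g) * (upper_sum n F ^ d - poly_var F ^ d)"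
    have "monomial m0 * (var_or_one G * upper_sum n F ^ d) \<in> chow_ideal n"
      unfolding d_def using 3 \<open>F \<subseteq> {1..n}\<close> keys_m0 by (intro chow_ideal_mult var_upper_sum_power) auto
    moreover have "monomial m + q = monomial m0 * (var_or_one G * upper_sum n F ^ d)"
      by (subst m) (simp add: q_def monomial_add mon_g monomial_single algebra_simps)
    ultimately have "monomial m - poly_const (-1) * q \<in> chow_ideal n"
      by (simp add: poly_const.hom_uminus)
    moreover have "fy_reducible n (total_degree m) q"
    proof (rule fy_reducible_keys)
      have "homogeneous_size_ge n (total_degree (m0 + g)) (total_size (m0 + g)) (monomial (m0 + g))"
        using keys0 by (simp add: homogeneous_size_ge_def monomial_def)
      from homogeneous_size_ge_mult[OF this upper_sum_power_leading[OF F, of d]]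
      have q: "homogeneous_size_ge n (total_degree m) (Suc (total_size m)) q"
        unfolding q_def by (subst (1 2) m) (simp add: total_degree_add total_size_add)
      fix m' assume "m' \<in> Poly_Mapping.keys q"
      then have m': "Poly_Mapping.keys m' \<subseteq> nonempty_flats n" "total_degree m' = total_degree m" "total_size m < total_size m'"
        using q by (auto simp: homogeneous_size_ge_def Suc_le_eq)
      then have "n * total_degree m' - total_size m' < n * total_degree m - total_size m"
        using total_size_le[OF m'(1)] by simp
      from less.hyps[OF this m'(1)] show "fy_reducible n (total_degree m) (monomial m')"
        by (simp add: m'(2))
    qed
    ultimately show ?thesis
      by (blast intro: fy_reducible_cong fy_reducible_scale)
  qed
qed

lemma fy_reducible_homogeneous:
  assumes "p \<in> flat_polys n" "homogeneous_poly k p"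
  shows "fy_reducible n k p"
proof (rule fy_reducible_keys)
  fix m assume "m \<in> Poly_Mapping.keys p"
  then show "fy_reducible n k (monomial m)"
    using assms fy_reducible_monomial[of m n] by (auto simp: flat_polys_iff homogeneous_poly_iff)
qed

section \<open>Evaluation at complete flags\<close>

text \<open>
  The coordinates of the members of the flag are all nonzero, and they are chosen so that those of the
  members containing \<open>i\<close> add up to \<open>i\<close>.
\<close>

definition flag_coord :: "nat \<Rightarrow> (nat \<Rightarrow> nat) \<Rightarrow> nat set \<Rightarrow> rat"
  where "flag_coord n w F = (let u = \<lambda>j. if j \<le> n then rat_of_nat (w j) else 0 in
    if F = w ` {1..card F} then u (card F) - u (Suc (card F)) else 0)"

text \<open>The variable of \<open>rat poly\<close> is the scaling parameter \<open>s\<close>. Kept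
  formal, its \<open>k\<close>-th power marks the contribution of the monomials of degree
  \<open>k\<close>.\<close>

definition eval_flag :: "nat \<Rightarrow> (nat \<Rightarrow> nat) \<Rightarrow> flat_poly \<Rightarrow> rat poly"
  where "eval_flag n w = eval_poly (\<lambda>c. [:c:]) (\<lambda>F. monom (flag_coord n w F) 1)"

global_interpretation const_poly: coefficient_hom "\<lambda>c :: rat. [:c:]"
  by unfold_locales (auto simp: one_pCons)

lemmas eval_flag_simps =
  const_poly.eval_poly_add[where f = "\<lambda>F. monom (flag_coord n w F) 1" for n w, folded eval_flag_def]
  const_poly.eval_poly_diff[where f = "\<lambda>F. monom (flag_coord n w F) 1" for n w, folded eval_flag_def]
  const_poly.eval_poly_mult[where f = "\<lambda>F. monom (flag_coord n w F) 1" for n w, folded eval_flag_def]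
  const_poly.eval_poly_sum[where f = "\<lambda>F. monom (flag_coord n w F) 1" for n w, folded eval_flag_def]

lemma eval_flag_0 [simp]: "eval_flag n w 0 = 0"
  by (simp add: eval_flag_def)

lemma prod_monom: "(\<Prod>i\<in>A. monom (f i) (g i)) = monom (\<Prod>i\<in>A. f i) (\<Sum>i\<in>A. g i)"
  for f :: "'b \<Rightarrow> 'a::comm_semiring_1"
  by (induction A rule: infinite_finite_induct) (simp_all add: mult_monom)

lemma eval_flag_monomial:
  "eval_flag n w (monomial m) = monom (eval_monom (flag_coord n w) m) (total_degree m)"
proof -
  have "eval_monom (\<lambda>F. monom (flag_coord n w F) 1) m
      = (\<Prod>F\<in>Poly_Mapping.keys m. monom (flag_coord n w F ^ Poly_Mapping.lookup m F) (Poly_Mapping.lookup m F))"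
    by (simp add: eval_monom_def monom_power)
  also have "\<dots> = monom (eval_monom (flag_coord n w) m) (total_degree m)"
    by (simp only: prod_monom eval_monom_def total_degree_def)
  finally show ?thesis
    by (simp add: eval_flag_def monomial_def flip: one_pCons)
qed

lemma eval_flag_var: "eval_flag n w (poly_var F) = monom (flag_coord n w F) 1"
  using eval_flag_monomial[of n w "Poly_Mapping.single F 1"] by (simp add: monomial_single)

lemma eval_flag_const: "eval_flag n w (poly_const c) = [:c:]"
  by (simp add: eval_flag_def poly_const_def)

text \<open>Two members of one flag are always comparable, so \<open>F\<close> or \<open>G\<close>
  lies off the flag of \<open>w\<close>, where the coordinate is 0.\<close>

lemma flag_coord_incomparable:
  assumes "\<not> F \<subseteq> G" "\<not> G \<subseteq> F"
  shows "flag_coord n w F * flag_coord n w G = 0"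
proof -
  have "F \<noteq> w ` {1..card F} \<or> G \<noteq> w ` {1..card G}"
  proof (rule ccontr)
    assume "\<not> ?thesis"
    then have F: "F = w ` {1..card F}" and G: "G = w ` {1..card G}" by auto
    show False
    proof (cases "card F \<le> card G")
      case True
      then have "w ` {1..card F} \<subseteq> w ` {1..card G}" by (intro image_mono) auto
      then show False using assms F G by auto
    next
      case False
      then have "w ` {1..card G} \<subseteq> w ` {1..card F}" by (intro image_mono) auto
      then show False using assms F G by auto
    qed
  qed
  then show ?thesis by (auto simp: flag_coord_def)
qed

lemma card_flag:
  assumes "w permutes {1..n}"
  shows "card (w ` {1..j}) = j"
  using card_image[OF inj_on_subset[OF permutes_inj[OF assms]], of "{1..j}"] by simp

text \<open>The sum telescopes along the part of the flag that contains \<open>w j\<close>.\<close>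

lemma sum_flag_coord:
  assumes w: "w permutes {1..n}" and j: "j \<in> {1..n}"
  shows "(\<Sum>F\<in>{F \<in> nonempty_flats n. w j \<in> F}. flag_coord n w F) = rat_of_nat (w j)"
proof -
  define u where "u k = (if k \<le> n then rat_of_nat (w k) else 0)" for k
  have inj: "inj w" using w by (rule permutes_inj)
  have "(\<Sum>F\<in>{F \<in> nonempty_flats n. w j \<in> F}. flag_coord n w F)
      = (\<Sum>F\<in>(\<lambda>k. w ` {1..k}) ` {j..n}. flag_coord n w F)"
  proof (rule sum.mono_neutral_right)
    show "(\<lambda>k. w ` {1..k}) ` {j..n} \<subseteq> {F \<in> nonempty_flats n. w j \<in> F}"
    proof (clarify)
      fix k assume k: "k \<in> {j..n}"
      have "w ` {1..k} \<subseteq> w ` {1..n}" using k by (intro image_mono) auto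
      then have "w ` {1..k} \<subseteq> {1..n}" using permutes_image[OF w] by simp
      moreover have "w j \<in> w ` {1..k}" using j k by auto
      ultimately show "w ` {1..k} \<in> nonempty_flats n \<and> w j \<in> w ` {1..k}"
        by (auto simp: nonempty_flats_def)
    qed
    show "\<forall>F\<in>{F \<in> nonempty_flats n. w j \<in> F} - (\<lambda>k. w ` {1..k}) ` {j..n}. flag_coord n w F = 0"
    proof
      fix F assume F: "F \<in> {F \<in> nonempty_flats n. w j \<in> F} - (\<lambda>k. w ` {1..k}) ` {j..n}"
      then have "F \<subseteq> {1..n}" by (simp add: nonempty_flats_def)
      then have "card F \<le> n" using card_mono[of "{1..n}" F] by simp
      have "F \<noteq> w ` {1..card F}"
      proof
        assume eq: "F = w ` {1..card F}"
        have "w j \<in> F" using F by simp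
        then have "w j \<in> w ` {1..card F}" by (subst (asm) eq)
        then have "j \<in> {1..card F}" by (simp only: inj_image_mem_iff[OF inj])
        then have "card F \<in> {j..n}" using \<open>card F \<le> n\<close> by simp
        then have "F \<in> (\<lambda>k. w ` {1..k}) ` {j..n}" by (rule rev_image_eqI) (rule eq)
        then show False using F by simp
      qed
      then show "flag_coord n w F = 0" by (simp add: flag_coord_def)
    qed
  qed simp
  also have "\<dots> = (\<Sum>k\<in>{j..n}. flag_coord n w (w ` {1..k}))"
  proof (subst sum.reindex)
    show "inj_on (\<lambda>k. w ` {1..k}) {j..n}"
      by (rule inj_on_inverseI[where g = card]) (rule card_flag[OF w])
  qed (simp only: o_def)
  also have "\<dots> = (\<Sum>k\<in>{j..n}. u k - u (Suc k))"
    by (rule sum.cong) (simp_all only: flag_coord_def card_flag[OF w] u_def Let_def simp_thms if_True)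
  also have "\<dots> = u j - u (Suc n)"
    using sum_Suc_diff[of j n "\<lambda>k. - u k"] j by (simp add: algebra_simps)
  also have "\<dots> = rat_of_nat (w j)"
    using j by (simp add: u_def)
  finally show ?thesis .
qed

text \<open>
  The whole ideal inherits this property from its generators, as evaluation is multiplicative.
\<close>

definition deformable :: "nat \<Rightarrow> flat_poly set"
  where "deformable n = {p \<in> flat_polys n. \<exists>q \<in> flat_polys n.
    \<forall>w. w permutes {1..n} \<longrightarrow> eval_flag n w p = monom 1 1 * eval_flag n w q}"

lemma ideal_deformable: "ideal (deformable n) (flat_poly_ring n)"
proof -
  interpret R: cring "flat_poly_ring n" by (rule cring_flat_poly_ring)
  have add: "p + q \<in> deformable n" if "p \<in> deformable n" "q \<in> deformable n" for p q
  proof -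
    obtain p' q' where "p' \<in> flat_polys n" "q' \<in> flat_polys n"
      "\<And>w. w permutes {1..n} \<Longrightarrow> eval_flag n w p = monom 1 1 * eval_flag n w p'"
      "\<And>w. w permutes {1..n} \<Longrightarrow> eval_flag n w q = monom 1 1 * eval_flag n w q'"
      using \<open>p \<in> _\<close> \<open>q \<in> _\<close> by (auto simp: deformable_def)
    then show ?thesis
      using that by (auto simp: deformable_def eval_flag_simps distrib_left intro!: bexI[of _ "p' + q'"])
  qed
  have mult: "r * p \<in> deformable n" if "p \<in> deformable n" "r \<in> flat_polys n" for p r
  proof -
    obtain p' where "p' \<in> flat_polys n" "\<And>w. w permutes {1..n} \<Longrightarrow> eval_flag n w p = monom 1 1 * eval_flag n w p'"
      using \<open>p \<in> _\<close> by (auto simp: deformable_def)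
    then show ?thesis
      using that by (auto simp: deformable_def eval_flag_simps mult_ac intro!: bexI[of _ "r * p'"])
  qed
  have zero: "0 \<in> deformable n"
    by (auto simp: deformable_def intro!: bexI[of _ 0])
  have inv: "\<ominus>\<^bsub>flat_poly_ring n\<^esub> p \<in> deformable n" if "p \<in> deformable n" for p
  proof -
    have "p \<in> flat_polys n" using that by (simp add: deformable_def)
    then have "\<ominus>\<^bsub>flat_poly_ring n\<^esub> p = - p"
      by (intro R.minus_equality) auto
    then show ?thesis using mult[OF that, of "-1"] by simp
  qed
  show ?thesis
  proof (rule idealI)
    show "subgroup (deformable n) (add_monoid (flat_poly_ring n))"
    proof (rule group.subgroupI[OF R.a_group])
      show "deformable n \<subseteq> carrier (add_monoid (flat_poly_ring n))" by (auto simp: deformable_def)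
      show "deformable n \<noteq> {}" using zero by auto
    qed (use add inv in \<open>simp_all add: a_inv_def\<close>)
  qed (use mult R.ring_axioms in \<open>auto simp: mult.commute\<close>)
qed

text \<open>The witness is 0 for an incomparable product and the constant \<open>i\<close> for the
  linear form of \<open>i\<close>. It is one polynomial for all \<open>w\<close>, so it can be
  straightened again with coefficients independent of \<open>w\<close>.\<close>

lemma chow_ideal_deformable: "chow_ideal n \<subseteq> deformable n"
proof (rule chow_ideal_minimal[OF ideal_deformable])
  fix F G assume FG: "F \<in> nonempty_flats n" "G \<in> nonempty_flats n" "\<not> F \<subseteq> G" "\<not> G \<subseteq> F"
  then have "eval_flag n w (poly_var F * poly_var G) = 0" for w
    using flag_coord_incomparable[OF FG(3,4)] by (simp add: eval_flag_simps eval_flag_var mult_monom)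
  then show "poly_var F * poly_var G \<in> deformable n"
    using FG by (auto simp: deformable_def intro!: bexI[of _ 0])
next
  fix i assume i: "i \<in> {1..n}"
  have "eval_flag n w (\<Sum>F\<in>{F \<in> nonempty_flats n. i \<in> F}. poly_var F)
      = monom 1 1 * eval_flag n w (poly_const (rat_of_nat i))" if w: "w permutes {1..n}" for w
  proof -
    obtain j where j: "j \<in> {1..n}" "w j = i"
      using permutes_image[OF w] i by (metis imageE)
    have "eval_flag n w (\<Sum>F\<in>{F \<in> nonempty_flats n. i \<in> F}. poly_var F)
        = monom (\<Sum>F\<in>{F \<in> nonempty_flats n. i \<in> F}. flag_coord n w F) 1"
      by (simp add: eval_flag_simps eval_flag_var monom_sum)
    also have "\<dots> = monom (rat_of_nat i) 1"
      using sum_flag_coord[OF w j(1)] j(2) by simp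
    finally show ?thesis
      by (simp add: eval_flag_const mult_monom smult_monom)
  qed
  then show "(\<Sum>F\<in>{F \<in> nonempty_flats n. i \<in> F}. poly_var F) \<in> deformable n"
    by (auto simp: deformable_def intro!: flat_polys_sum bexI[of _ "poly_const (rat_of_nat i)"])
qed

section \<open>Linear independence\<close>

lemma chow_ideal_eval_flagE:
  assumes "p \<in> chow_ideal n"
  obtains q where "q \<in> flat_polys n"
    "\<And>w. w permutes {1..n} \<Longrightarrow> eval_flag n w p = monom 1 1 * eval_flag n w q"
  using assms subsetD[OF chow_ideal_deformable] unfolding deformable_def by blast

text \<open>The \<open>card W\<close> point indicators are independent and lie in the span of at
  most \<open>card W\<close> vectors. Hence all cardinalities agree, and the vectors are pairwise
  distinct and independent.\<close>

lemma spanning_family_independent: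
  fixes v :: "'m \<Rightarrow> 'w \<Rightarrow> 'k::field"
  assumes fin: "finite M" "finite W" and card: "card M \<le> card W"
    and span: "\<And>w. w \<in> W \<Longrightarrow> \<exists>c. \<forall>w'\<in>W. (\<Sum>m\<in>M. c m * v m w') = (if w' = w then 1 else 0)"
    and zero: "\<And>w. w \<in> W \<Longrightarrow> (\<Sum>m\<in>M. c m * v m w) = 0"
    and m: "m \<in> M"
  shows "c m = 0"
proof -
  define scale where "scale a f = (\<lambda>x. a * f x)" for a :: 'k and f :: "'w \<Rightarrow> 'k"
  interpret V: vector_space scale
    by unfold_locales (auto simp: scale_def fun_eq_iff algebra_simps)
  define \<delta> :: "'w \<Rightarrow> 'w \<Rightarrow> 'k" where "\<delta> w = (\<lambda>x. if x = w then 1 else 0)" for w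
  \<comment> \<open>Setting the values outside \<open>W\<close> to 0 turns identities on
    \<open>W\<close> into identities of total functions.\<close>
  define v' where "v' m = (\<lambda>x. if x \<in> W then v m x else 0)" for m
  have sum_apply: "(\<Sum>i\<in>A. g i) x = (\<Sum>i\<in>A. g i x)" for g :: "'b \<Rightarrow> 'w \<Rightarrow> 'k" and A x
    by (induction A rule: infinite_finite_induct) auto
  have inj_\<delta>: "inj_on \<delta> W"
    by (rule inj_onI) (metis \<delta>_def one_neq_zero)
  have "V.independent (\<delta> ` W)"
    unfolding V.independent_explicit_finite_subsets
  proof (intro allI impI ballI)
    fix S u f assume S: "S \<subseteq> \<delta> ` W" "finite S" and sum: "(\<Sum>f\<in>S. scale (u f) f) = 0" and f: "f \<in> S"
    then obtain w where w: "f = \<delta> w" by auto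
    have "(\<Sum>g\<in>S. u g * g w) = 0"
      using fun_cong[OF sum, of w] by (simp add: sum_apply scale_def)
    moreover have "u g * g w = (if g = f then u f else 0)" if "g \<in> S" for g
    proof -
      obtain x where "x \<in> W" "g = \<delta> x" using S(1) \<open>g \<in> S\<close> by auto
      moreover have "\<delta> w w = 1" "x \<noteq> w \<Longrightarrow> \<delta> x w = 0" by (simp_all add: \<delta>_def)
      ultimately show ?thesis using w by (cases "x = w") auto
    qed
    ultimately show "u f = 0"
      using f S by simp
  qed
  moreover have "\<delta> w \<in> V.span (v' ` M)" if w: "w \<in> W" for w
  proof -
    obtain d where d: "\<forall>w'\<in>W. (\<Sum>m\<in>M. d m * v m w') = (if w' = w then 1 else 0)"
      using span[OF w] by blast
    have "\<delta> w = (\<Sum>m\<in>M. scale (d m) (v' m))"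
    proof
      fix x show "\<delta> w x = (\<Sum>m\<in>M. scale (d m) (v' m)) x"
        using d w by (cases "x \<in> W") (auto simp: sum_apply scale_def v'_def \<delta>_def)
    qed
    then show ?thesis
      by (simp add: V.span_sum V.span_scale V.span_base)
  qed
  moreover obtain B where B: "B \<subseteq> v' ` M" "V.independent B" "v' ` M \<subseteq> V.span B"
    using V.maximal_independent_subset by blast
  moreover have fin_B: "finite B" using B(1) fin(1) finite_subset by blast
  ultimately have "card (\<delta> ` W) \<le> card B"
    using V.independent_span_bound[of B "\<delta> ` W"] V.span_minimal[OF B(3) V.subspace_span] by blast
  then have "card M \<le> card B"
    using card by (simp add: card_image[OF inj_\<delta>])
  moreover have "card B \<le> card (v' ` M)" "card (v' ` M) \<le> card M"
    using B(1) fin(1) by (auto intro: card_mono card_image_le)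
  ultimately have eq: "card B = card (v' ` M)" "card (v' ` M) = card M" by auto
  then have "B = v' ` M" using B(1) fin(1) by (simp add: card_subset_eq)
  then have indep: "V.independent (v' ` M)" using B(2) by simp
  have inj: "inj_on v' M" using eq(2) fin(1) by (simp add: eq_card_imp_inj_on)
  define u where "u f = c (the_inv_into M v' f)" for f
  have u: "u (v' m) = c m" if "m \<in> M" for m
    unfolding u_def using that inj by (simp add: the_inv_into_f_f)
  have "(\<Sum>f\<in>v' ` M. scale (u f) f) = (\<Sum>m\<in>M. scale (c m) (v' m))"
    by (subst sum.reindex[OF inj]) (simp add: u)
  also have "\<dots> = 0"
  proof
    fix x show "(\<Sum>m\<in>M. scale (c m) (v' m)) x = 0 x"
      using zero[of x] by (cases "x \<in> W") (simp_all add: sum_apply scale_def v'_def)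
  qed
  finally have "u (v' m) = 0"
    using V.independentD[OF indep, of "v' ` M" u "v' m"] fin(1) m by auto
  then show ?thesis using u[OF m] by simp
qed

definition fy_sum :: "nat \<Rightarrow> ((nat set \<Rightarrow>\<^sub>0 nat) \<Rightarrow> rat) \<Rightarrow> flat_poly"
  where "fy_sum n c = (\<Sum>m \<in> fy_exponents n {}. poly_const (c m) * monomial m)"

lemma fy_combination_eq_fy_sum: "fy_combination n k c = fy_sum n (\<lambda>m. if total_degree m = k then c m else 0)"
  unfolding fy_combination_def fy_sum_def
  by (rule sum.mono_neutral_cong_left) auto

lemma fy_spanning:
  assumes "p \<in> flat_polys n"
  shows "\<exists>c. p - fy_sum n c \<in> chow_ideal n"
proof -
  have "\<exists>c. monomial m - fy_sum n c \<in> chow_ideal n" if "m \<in> Poly_Mapping.keys p" for m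
    using fy_reducible_monomial[of m n] assms that
    unfolding fy_reducible_def flat_polys_iff fy_combination_eq_fy_sum by blast
  then obtain c where c: "\<And>m. m \<in> Poly_Mapping.keys p \<Longrightarrow> monomial m - fy_sum n (c m) \<in> chow_ideal n"
    by metis
  let ?d = "\<lambda>m'. \<Sum>m\<in>Poly_Mapping.keys p. Poly_Mapping.lookup p m * c m m'"
  have const_sum: "poly_const (\<Sum>i\<in>A. g i) = (\<Sum>i\<in>A. poly_const (g i))" for g :: "'b \<Rightarrow> rat" and A
    by (induction A rule: infinite_finite_induct) (auto simp: poly_const.hom_add)
  have "(\<Sum>m\<in>Poly_Mapping.keys p. poly_const (Poly_Mapping.lookup p m) * (monomial m - fy_sum n (c m))) \<in> chow_ideal n"
    using c by (intro chow_ideal_sum chow_ideal_mult) auto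
  moreover have "(\<Sum>m\<in>Poly_Mapping.keys p. poly_const (Poly_Mapping.lookup p m) * fy_sum n (c m)) = fy_sum n ?d"
    unfolding fy_sum_def sum_distrib_left const_sum sum_distrib_right
    by (subst sum.swap) (simp add: poly_const.hom_mult mult.assoc)
  ultimately have "p - fy_sum n ?d \<in> chow_ideal n"
    by (simp add: right_diff_distrib sum_subtractf flip: flat_poly_eq_sum)
  then show ?thesis by blast
qed

abbreviation flag_value :: "nat \<Rightarrow> (nat set \<Rightarrow>\<^sub>0 nat) \<Rightarrow> (nat \<Rightarrow> nat) \<Rightarrow> rat"
  where "flag_value n m w \<equiv> eval_monom (flag_coord n w) m"

lemma coeff_eval_flag_fy_sum:
  "coeff (eval_flag n w (fy_sum n c)) k
    = (\<Sum>m\<in>fy_exponents n {}. (if total_degree m = k then c m else 0) * flag_value n m w)"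
  unfolding fy_sum_def eval_flag_simps eval_flag_const eval_flag_monomial coeff_sum
  by (intro sum.cong) (auto simp: smult_monom)

text \<open>Straightening \<open>q\<close> leaves an element of the ideal, which evaluates to
  \<open>s\<close> times some \<open>r\<close>. So the coefficient of \<open>q\<close> at
  \<open>s^k\<close> is that of a Feichtner-Yuzvinsky sum plus the coefficient of \<open>r\<close>
  at \<open>s^(k-1)\<close>. The degree restriction on \<open>c\<close> is what later separates the
  degrees in \<open>fy_independent\<close>.\<close>

lemma coeff_eval_flag_span:
  "q \<in> flat_polys n \<Longrightarrow> \<exists>c. (\<forall>m. k < total_degree m \<longrightarrow> c m = 0) \<and>
    (\<forall>w. w permutes {1..n} \<longrightarrow> coeff (eval_flag n w q) k = (\<Sum>m\<in>fy_exponents n {}. c m * flag_value n m w))"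
proof (induction k arbitrary: q)
  case (0 q)
  obtain c where "q - fy_sum n c \<in> chow_ideal n" using fy_spanning[OF 0] by blast
  then obtain r where r: "\<And>w. w permutes {1..n} \<Longrightarrow> eval_flag n w (q - fy_sum n c) = monom 1 1 * eval_flag n w r"
    using chow_ideal_eval_flagE by blast
  have "coeff (eval_flag n w q) 0 = coeff (eval_flag n w (fy_sum n c)) 0" if "w permutes {1..n}" for w
    using arg_cong[OF r[OF that], of "\<lambda>p. coeff p 0"] by (simp add: eval_flag_simps coeff_monom_mult)
  then show ?case
    by (intro exI[of _ "\<lambda>m. if total_degree m = 0 then c m else 0"]) (simp add: coeff_eval_flag_fy_sum)
next
  case (Suc k q)
  obtain c where "q - fy_sum n c \<in> chow_ideal n" using fy_spanning[OF Suc.prems] by blast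
  then obtain r where "r \<in> flat_polys n"
    and r: "\<And>w. w permutes {1..n} \<Longrightarrow> eval_flag n w (q - fy_sum n c) = monom 1 1 * eval_flag n w r"
    using chow_ideal_eval_flagE by blast
  from Suc.IH[OF this(1)] obtain d where d: "\<forall>m. k < total_degree m \<longrightarrow> d m = 0"
    "\<forall>w. w permutes {1..n} \<longrightarrow> coeff (eval_flag n w r) k = (\<Sum>m\<in>fy_exponents n {}. d m * flag_value n m w)"
    by blast
  have "coeff (eval_flag n w q) (Suc k) = coeff (eval_flag n w (fy_sum n c)) (Suc k) + coeff (eval_flag n w r) k"
    if "w permutes {1..n}" for w
    using arg_cong[OF r[OF that], of "\<lambda>p. coeff p (Suc k)"] by (simp add: eval_flag_simps coeff_monom_mult algebra_simps)
  then show ?case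
    using d by (intro exI[of _ "\<lambda>m. (if total_degree m = Suc k then c m else 0) + d m"])
      (simp add: coeff_eval_flag_fy_sum distrib_right sum.distrib)
qed

text \<open>The value at \<open>j\<close> is the one element that the \<open>j\<close>-th member of
  the flag adds to its predecessor.\<close>

lemma permutes_eq_flag:
  fixes n :: nat
  assumes v: "v permutes {1..n}" and w: "w permutes {1..n}"
    and flags: "\<And>j. j \<in> {1..n} \<Longrightarrow> w ` {1..j} = v ` {1..j}"
  shows "v = w"
proof
  fix j :: nat
  have diff: "p ` {1..j} - p ` {1..j - 1} = {p j}" if "j \<in> {1..n}" "p permutes {1..n}" for p :: "nat \<Rightarrow> nat"
  proof -
    have "p ` {1..j} - p ` {1..j - 1} = p ` ({1..j} - {1..j - 1})"
      using permutes_inj[OF that(2)] by (simp only: image_set_diff)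
    also have "{1..j} - {1..j - 1} = {j}" using that(1) by auto
    finally show ?thesis by simp
  qed
  show "v j = w j"
  proof (cases "j \<in> {1..n}")
    case True
    have "w ` {1..j - 1} = v ` {1..j - 1}"
    proof (cases "j - 1 = 0")
      case False
      then show ?thesis using True by (intro flags) auto
    qed simp
    then show ?thesis
      using diff[OF True v] diff[OF True w] flags[OF True] by simp
  next
    case False
    then show ?thesis using v w by (metis permutes_not_in)
  qed
qed

text \<open>The product of all variables along the flag of \<open>w\<close> vanishes at every other
  flag, and \<open>coeff_eval_flag_span\<close> rewrites its values through Feichtner-Yuzvinsky
  monomials. Dividing by its value at \<open>w\<close> normalizes it.\<close>

lemma flag_indicator:
  assumes w: "w permutes {1..n}"
  shows "\<exists>c. \<forall>v\<in>{v. v permutes {1..n}}. (\<Sum>m\<in>fy_exponents n {}. c m * flag_value n m v) = (if v = w then 1 else 0)"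
proof -
  define q where "q = (\<Prod>j = 1..n. poly_var (w ` {1..j}))"
  define K where "K v = (\<Prod>j = 1..n. flag_coord n v (w ` {1..j}))" for v
  have "w ` {1..j} \<in> nonempty_flats n" if "j \<in> {1..n}" for j
    using image_mono[of "{1..j}" "{1..n}" w] permutes_image[OF w] that by (auto simp: nonempty_flats_def)
  then have "q \<in> flat_polys n"
    unfolding q_def by (intro flat_polys_prod flat_polys_var)
  then obtain c where c: "\<And>v. v permutes {1..n} \<Longrightarrow>
      coeff (eval_flag n v q) n = (\<Sum>m\<in>fy_exponents n {}. c m * flag_value n m v)"
    using coeff_eval_flag_span by blast
  have "eval_flag n v q = (\<Prod>j = 1..n. eval_flag n v (poly_var (w ` {1..j})))" for v
    unfolding q_def eval_flag_def by (rule const_poly.eval_poly_prod)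
  then have coeff: "coeff (eval_flag n v q) n = K v" for v
    by (simp add: eval_flag_var prod_monom K_def del: One_nat_def)
  have "K v = 0" if "v permutes {1..n}" "v \<noteq> w" for v
  proof -
    have "\<exists>j\<in>{1..n}. w ` {1..j} \<noteq> v ` {1..j}"
      using permutes_eq_flag[OF that(1) w] that(2) by blast
    then obtain j where "j \<in> {1..n}" "w ` {1..j} \<noteq> v ` {1..j}" by blast
    then have "flag_coord n v (w ` {1..j}) = 0"
      unfolding flag_coord_def card_flag[OF w] by simp
    then show ?thesis
      unfolding K_def using \<open>j \<in> {1..n}\<close> by (intro prod_zero) auto
  qed
  \<comment> \<open>Consecutive values of \<open>w\<close> differ, and the last coordinate is
    \<open>w n\<close>, which is at least 1: this is where distinct nonzero values of the linear
    forms matter.\<close>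
  moreover have "flag_coord n w (w ` {1..j}) \<noteq> 0" if j: "j \<in> {1..n}" for j
  proof (cases "j = n")
    case True
    then have "w j \<in> {1..n}" using permutes_in_image[OF w, of j] j by simp
    then show ?thesis unfolding flag_coord_def card_flag[OF w] using True by simp
  next
    case False
    have "w j \<noteq> w (Suc j)" using permutes_inj[OF w] by (metis injD n_not_Suc_n)
    then show ?thesis unfolding flag_coord_def card_flag[OF w] using False j by simp
  qed
  then have "K w \<noteq> 0" unfolding K_def by (subst prod_zero_iff) auto
  ultimately have quotient: "K v / K w = (if v = w then 1 else 0)" if "v permutes {1..n}" for v
    using that by simp
  have "(\<Sum>m\<in>fy_exponents n {}. (c m / K w) * flag_value n m v) = (if v = w then 1 else 0)"
    if "v permutes {1..n}" for v
  proof -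
    have "(\<Sum>m\<in>fy_exponents n {}. (c m / K w) * flag_value n m v) = K v / K w"
      using c[OF that] coeff[of v] by (simp add: sum_divide_distrib)
    then show ?thesis using quotient[OF that] by simp
  qed
  then show ?thesis by (intro exI[of _ "\<lambda>m. c m / K w"]) blast
qed

text \<open>The indicators are in the span of the values, and the exponents are at most as numerous
  as the \<open>fact n\<close> permutations.\<close>

lemma flag_values_independent:
  assumes "\<And>w. w permutes {1..n} \<Longrightarrow> (\<Sum>m\<in>fy_exponents n {}. c m * flag_value n m w) = 0"
    and "m \<in> fy_exponents n {}"
  shows "c m = 0"
proof (rule spanning_family_independent[where W = "{w. w permutes {1..n}}" and M = "fy_exponents n {}" and v = "flag_value n"])
  show "card (fy_exponents n {}) \<le> card {w. w permutes {1..n}}"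
    using fy_exponents_bound[of "{}" n] card_permutations[of "{1..n}" n] by simp
qed (use assms flag_indicator in \<open>auto simp: finite_permutations\<close>)

text \<open>At \<open>k\<close>, the degree of \<open>m\<close>, the degree \<open>k\<close> terms
  of the relation agree at all flags with a combination \<open>d\<close> of monomials of smaller
  degree. As the values of all degrees are jointly independent,
  \<open>c m = d m = 0\<close>.\<close>

lemma fy_independent:
  assumes "fy_sum n c \<in> chow_ideal n" "m \<in> fy_exponents n {}"
  shows "c m = 0"
proof -
  obtain q where q: "q \<in> flat_polys n"
    "\<And>w. w permutes {1..n} \<Longrightarrow> eval_flag n w (fy_sum n c) = monom 1 1 * eval_flag n w q"
    using assms(1) chow_ideal_eval_flagE by blast
  define k where "k = total_degree m"
  have coeff: "(\<Sum>m\<in>fy_exponents n {}. (if total_degree m = k then c m else 0) * flag_value n m w)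
      = (if k = 0 then 0 else coeff (eval_flag n w q) (k - 1))" if "w permutes {1..n}" for w
    using arg_cong[OF q(2)[OF that], of "\<lambda>p. coeff p k"]
    by (auto simp: coeff_monom_mult simp flip: coeff_eval_flag_fy_sum)
  obtain d where d: "d m = 0" "\<And>w. w permutes {1..n} \<Longrightarrow>
      (if k = 0 then 0 else coeff (eval_flag n w q) (k - 1)) = (\<Sum>m\<in>fy_exponents n {}. d m * flag_value n m w)"
  \<comment> \<open>For \<open>k = 0\<close> the coefficient vanishes because of the factor
    \<open>s\<close>, and \<open>d\<close> is zero; the case is separate since \<open>k - 1\<close>
    truncates.\<close>
  proof (cases "k = 0")
    case True
    then show ?thesis using that[of "\<lambda>_. 0"] by simp
  next
    case False
    obtain d where d: "\<forall>m. k - 1 < total_degree m \<longrightarrow> d m = 0"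
      "\<forall>w. w permutes {1..n} \<longrightarrow> coeff (eval_flag n w q) (k - 1) = (\<Sum>m\<in>fy_exponents n {}. d m * flag_value n m w)"
      using coeff_eval_flag_span[OF q(1), of "k - 1"] by blast
    then show ?thesis using False that[of d] by (simp add: k_def)
  qed
  have "(if total_degree m = k then c m else 0) - d m = 0"
  proof (rule flag_values_independent[OF _ assms(2)])
    fix w assume "w permutes {1..n}"
    then show "(\<Sum>m\<in>fy_exponents n {}. ((if total_degree m = k then c m else 0) - d m) * flag_value n m w) = 0"
      using coeff d(2) by (simp add: left_diff_distrib sum_subtractf)
  qed
  then show ?thesis using d(1) by (simp add: k_def)
qed

section \<open>The action of the symmetric group\<close>

lemma perm_poly_simps:
  "perm_poly \<sigma> 0 = 0"
  "perm_poly \<sigma> (p + q) = perm_poly \<sigma> p + perm_poly \<sigma> q"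
  "perm_poly \<sigma> (p - q) = perm_poly \<sigma> p - perm_poly \<sigma> q"
  "perm_poly \<sigma> (p * q) = perm_poly \<sigma> p * perm_poly \<sigma> q"
  "perm_poly \<sigma> (sum g A) = (\<Sum>i\<in>A. perm_poly \<sigma> (g i))"
  "perm_poly \<sigma> (prod g A) = (\<Prod>i\<in>A. perm_poly \<sigma> (g i))"
  by (simp_all add: perm_poly_eq_eval_poly poly_const.eval_poly_add poly_const.eval_poly_diff
      poly_const.eval_poly_mult poly_const.eval_poly_sum poly_const.eval_poly_prod)

lemma perm_poly_const: "perm_poly \<sigma> (poly_const c) = poly_const c"
  using poly_const.eval_poly_single[of _ 0 c] by (simp add: perm_poly_eq_eval_poly poly_const_def)

lemma perm_poly_1 [simp]: "perm_poly \<sigma> 1 = 1"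
  by (simp add: perm_poly_eq_eval_poly)

lemma perm_poly_power: "perm_poly \<sigma> (p ^ k) = perm_poly \<sigma> p ^ k"
  by (induction k) (simp_all add: perm_poly_simps)

lemma eval_monom_var_image:
  "eval_monom (\<lambda>F. poly_var (f F)) m
    = monomial (\<Sum>F\<in>Poly_Mapping.keys m. Poly_Mapping.single (f F) (Poly_Mapping.lookup m F))"
  by (simp add: eval_monom_sum flip: eval_monom_poly_var) (simp add: eval_monom_def)

lemma perm_poly_eq_sum:
  "perm_poly \<sigma> p = (\<Sum>m\<in>Poly_Mapping.keys p. poly_const (Poly_Mapping.lookup p m) *
    monomial (\<Sum>F\<in>Poly_Mapping.keys m. Poly_Mapping.single (\<sigma> ` F) (Poly_Mapping.lookup m F)))"
  by (simp add: perm_poly_eq_eval_poly eval_poly_def eval_monom_var_image)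

lemma perm_poly_monomial: "perm_poly \<sigma> (monomial m) = (\<Prod>F\<in>Poly_Mapping.keys m. poly_var (\<sigma> ` F) ^ Poly_Mapping.lookup m F)"
  by (simp add: perm_poly_simps perm_poly_power perm_poly_var eval_monom_def flip: eval_monom_poly_var)

lemma perm_poly_comp: "perm_poly (\<sigma> \<circ> \<tau>) p = perm_poly \<sigma> (perm_poly \<tau> p)"
proof -
  have "perm_poly (\<sigma> \<circ> \<tau>) (monomial m) = perm_poly \<sigma> (perm_poly \<tau> (monomial m))" for m
    by (simp add: perm_poly_monomial perm_poly_simps perm_poly_power perm_poly_var image_comp)
  then show ?thesis
    by (subst (1 2) flat_poly_eq_sum[of p]) (simp add: perm_poly_simps perm_poly_const)
qed

lemma perm_poly_id: "perm_poly id p = p"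
proof -
  have "perm_poly id (monomial m) = monomial m" for m
    unfolding perm_poly_monomial by (simp add: eval_monom_poly_var flip: eval_monom_def)
  then show ?thesis
    by (subst (1 2) flat_poly_eq_sum[of p]) (simp add: perm_poly_simps perm_poly_const)
qed

lemma perm_poly_inv:
  assumes "\<sigma> permutes S"
  shows "perm_poly (inv_into UNIV \<sigma>) (perm_poly \<sigma> p) = p" "perm_poly \<sigma> (perm_poly (inv_into UNIV \<sigma>) p) = p"
  using permutes_inv_o[OF assms] by (simp_all add: perm_poly_id flip: perm_poly_comp)

lemma permutes_image_flat:
  assumes "\<sigma> permutes {1..n}" "F \<in> nonempty_flats n"
  shows "\<sigma> ` F \<in> nonempty_flats n"
  using assms permutes_in_image[OF assms(1)] unfolding nonempty_flats_def by blast

lemma flat_polys_perm_poly: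
  assumes "\<sigma> permutes {1..n}" "p \<in> flat_polys n"
  shows "perm_poly \<sigma> p \<in> flat_polys n"
proof -
  have "(\<Sum>m\<in>Poly_Mapping.keys p. poly_const (Poly_Mapping.lookup p m) * perm_poly \<sigma> (monomial m)) \<in> flat_polys n"
    unfolding perm_poly_monomial using assms
    by (intro flat_polys_sum flat_polys_mult flat_polys_const flat_polys_prod flat_polys_power flat_polys_var permutes_image_flat)
      (auto simp: flat_polys_iff)
  then show ?thesis
    by (subst flat_poly_eq_sum[of p]) (simp add: perm_poly_simps perm_poly_const)
qed

section \<open>Invariance of degree, of the Feichtner-Yuzvinsky monomials and of the ideal\<close>

lemma homogeneous_add: "homogeneous_poly k p \<Longrightarrow> homogeneous_poly k q \<Longrightarrow> homogeneous_poly k (p + q)"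
  using keys_add[of p q] by (auto simp: homogeneous_poly_iff)

lemma homogeneous_0 [simp]: "homogeneous_poly k 0"
  by (simp add: homogeneous_poly_iff)

lemma homogeneous_sum: "(\<And>i. i \<in> A \<Longrightarrow> homogeneous_poly k (g i)) \<Longrightarrow> homogeneous_poly k (sum g A)"
  by (induction A rule: infinite_finite_induct) (auto simp: homogeneous_add)

lemma homogeneous_scale:
  assumes "homogeneous_poly k p"
  shows "homogeneous_poly k (poly_const c * p)"
proof -
  have "Poly_Mapping.keys (poly_const c * p) \<subseteq> Poly_Mapping.keys p"
    using keys_mult[of "poly_const c" p] by (auto simp: poly_const_def split: if_splits)
  then show ?thesis using assms by (auto simp: homogeneous_poly_iff)
qed

lemma total_degree_sum: "total_degree (\<Sum>i\<in>A. g i) = (\<Sum>i\<in>A. total_degree (g i))"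
  by (induction A rule: infinite_finite_induct) (auto simp: total_degree_add)

lemma homogeneous_perm_poly:
  assumes "homogeneous_poly k p"
  shows "homogeneous_poly k (perm_poly \<sigma> p)"
  unfolding perm_poly_eq_sum
  using assms by (intro homogeneous_sum homogeneous_scale)
    (simp add: homogeneous_poly_iff[of k p] total_degree_sum flip: total_degree_def)

lemma fy_chain_image:
  assumes "\<sigma> permutes {1..n}" "fy_chain n l F a"
  shows "fy_chain n l (\<lambda>i. \<sigma> ` F i) a"
proof -
  have inj: "inj \<sigma>" using assms(1) by (rule permutes_inj)
  have card: "card (\<sigma> ` G) = card G" for G
    using inj by (intro card_image inj_on_subset[OF inj]) simp
  have strict: "\<sigma> ` G \<subset> \<sigma> ` H \<longleftrightarrow> G \<subset> H" for G H
    using inj by (simp add: psubset_eq inj_image_subset_iff inj_image_eq_iff)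
  have "\<sigma> ` F l \<subseteq> {1..n}"
    using image_mono[of "F l" "{1..n}" \<sigma>] permutes_image[OF assms(1)] assms(2) by (simp add: fy_chain_def)
  then show ?thesis
    using assms(2) by (simp add: fy_chain_def card strict)
qed

lemma FY_perm_poly:
  assumes "\<sigma> permutes {1..n}" "p \<in> FY n"
  shows "perm_poly \<sigma> p \<in> FY n"
proof -
  obtain l F a where "p = (\<Prod>i = 1..l. poly_var (F i) ^ a i)" "l \<le> n" "fy_chain n l F a"
    using assms(2) unfolding FY_iff by blast
  moreover from this have "perm_poly \<sigma> p = (\<Prod>i = 1..l. poly_var (\<sigma> ` F i) ^ a i)"
    by (simp add: perm_poly_simps perm_poly_power perm_poly_var)
  ultimately show ?thesis
    unfolding FY_iff using fy_chain_image[OF assms(1)]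
    by (intro exI[of _ l] exI[of _ "\<lambda>i. \<sigma> ` F i"] exI[of _ a]) simp
qed

text \<open>The preimage of the ideal under \<open>perm_poly \<sigma>\<close> is an ideal. It
  contains the generators, as \<open>\<sigma>\<close> preserves incomparability and carries the
  linear form of \<open>i\<close> to that of \<open>\<sigma> i\<close>.\<close>

lemma chow_ideal_perm_poly:
  assumes \<sigma>: "\<sigma> permutes {1..n}" and p: "p \<in> chow_ideal n"
  shows "perm_poly \<sigma> p \<in> chow_ideal n"
proof -
  interpret R: cring "flat_poly_ring n" by (rule cring_flat_poly_ring)
  let ?J = "{p \<in> flat_polys n. perm_poly \<sigma> p \<in> chow_ideal n}"
  have "ideal ?J (flat_poly_ring n)"
  proof (rule idealI)
    show "subgroup ?J (add_monoid (flat_poly_ring n))"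
    proof (rule group.subgroupI[OF R.a_group])
      show "?J \<noteq> {}" by (auto simp: perm_poly_simps intro!: exI[of _ 0])
      fix a assume a: "a \<in> ?J"
      then have "\<ominus>\<^bsub>flat_poly_ring n\<^esub> a = 0 - a" by (intro R.minus_equality) auto
      then show "inv\<^bsub>add_monoid (flat_poly_ring n)\<^esub> a \<in> ?J"
        using a chow_ideal_diff[of 0 n "perm_poly \<sigma> a"] by (simp add: a_inv_def perm_poly_simps flip: diff_0)
    qed (auto simp: perm_poly_simps chow_ideal_add)
  next
    fix a x assume "a \<in> ?J" "x \<in> carrier (flat_poly_ring n)"
    then have "x * a \<in> ?J"
      using chow_ideal_mult flat_polys_perm_poly[OF \<sigma>] by (simp add: perm_poly_simps)
    then show "x \<otimes>\<^bsub>flat_poly_ring n\<^esub> a \<in> ?J" "a \<otimes>\<^bsub>flat_poly_ring n\<^esub> x \<in> ?J"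
      by (simp_all add: mult.commute)
  qed (rule R.ring_axioms)
  then have "chow_ideal n \<subseteq> ?J"
  proof (rule chow_ideal_minimal)
    fix F G assume FG: "F \<in> nonempty_flats n" "G \<in> nonempty_flats n" "\<not> F \<subseteq> G" "\<not> G \<subseteq> F"
    have "poly_var (\<sigma> ` F) * poly_var (\<sigma> ` G) \<in> chow_ideal n"
      using FG permutes_image_flat[OF \<sigma>] permutes_inj[OF \<sigma>]
      by (intro chow_ideal_incomparable) (simp_all add: inj_image_subset_iff)
    then show "poly_var F * poly_var G \<in> ?J"
      using FG by (simp add: perm_poly_simps perm_poly_var)
  next
    fix i assume i: "i \<in> {1..n}"
    have "(\<Sum>F\<in>{F \<in> nonempty_flats n. i \<in> F}. poly_var (\<sigma> ` F))
        = (\<Sum>F\<in>{F \<in> nonempty_flats n. \<sigma> i \<in> F}. poly_var F)"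
    proof (rule sum.reindex_bij_witness[where i = "(`) (inv_into UNIV \<sigma>)" and j = "(`) \<sigma>"])
      fix F assume F: "F \<in> {F \<in> nonempty_flats n. \<sigma> i \<in> F}"
      show "\<sigma> ` (inv_into UNIV \<sigma>) ` F = F"
        using permutes_surj[OF \<sigma>] by (rule image_f_inv_f)
      show "inv_into UNIV \<sigma> ` F \<in> {F \<in> nonempty_flats n. i \<in> F}"
        using F permutes_image_flat[OF permutes_inv[OF \<sigma>]] permutes_inverses(2)[OF \<sigma>, of i]
        by (auto simp: image_iff) metis
    next
      fix F assume F: "F \<in> {F \<in> nonempty_flats n. i \<in> F}"
      show "inv_into UNIV \<sigma> ` \<sigma> ` F = F"
        using permutes_inj[OF \<sigma>] by (rule image_inv_f_f)
      show "\<sigma> ` F \<in> {F \<in> nonempty_flats n. \<sigma> i \<in> F}"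
        using F permutes_image_flat[OF \<sigma>] by auto
    qed simp
    moreover have "\<sigma> i \<in> {1..n}" using permutes_in_image[OF \<sigma>] i by simp
    ultimately have "perm_poly \<sigma> (\<Sum>F\<in>{F \<in> nonempty_flats n. i \<in> F}. poly_var F) \<in> chow_ideal n"
      using chow_ideal_linear by (simp add: perm_poly_simps perm_poly_var)
    then show "(\<Sum>F\<in>{F \<in> nonempty_flats n. i \<in> F}. poly_var F) \<in> ?J"
      by (auto intro!: flat_polys_sum)
  qed
  then show ?thesis using p by blast
qed

section \<open>The Chow ring as a representation\<close>

lemma in_chow_class_iff: "q \<in> chow_class n p \<longleftrightarrow> q - p \<in> chow_ideal n"
proof -
  have "chow_class n p = (\<lambda>a. a + p) ` chow_ideal n"
    unfolding chow_class_def a_r_coset_def' by auto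
  then show ?thesis by (force simp: image_iff)
qed

lemma chow_class_eq_iff: "chow_class n p = chow_class n q \<longleftrightarrow> p - q \<in> chow_ideal n"
proof
  assume "chow_class n p = chow_class n q"
  then show "p - q \<in> chow_ideal n"
    using in_chow_class_iff[of p n p] in_chow_class_iff[of p n q] by simp
next
  assume pq: "p - q \<in> chow_ideal n"
  have "r - p \<in> chow_ideal n \<longleftrightarrow> r - q \<in> chow_ideal n" for r
    using chow_ideal_add[OF _ pq, of "r - p"] chow_ideal_diff[OF _ pq, of "r - q"] by auto
  then show "chow_class n p = chow_class n q"
    by (auto simp: in_chow_class_iff)
qed

lemma chow_class_0: "chow_class n 0 = chow_ideal n"
  by (auto simp: in_chow_class_iff)

lemma chow_class_add: "chow_class n p <+>\<^bsub>flat_poly_ring n\<^esub> chow_class n q = chow_class n (p + q)"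
proof -
  have "\<exists>x\<in>chow_class n p. \<exists>y\<in>chow_class n q. r = x + y" if "r \<in> chow_class n (p + q)" for r
    using that by (intro bexI[of _ "r - q"] bexI[of _ q]) (auto simp: in_chow_class_iff algebra_simps)
  moreover have "x + y \<in> chow_class n (p + q)" if "x \<in> chow_class n p" "y \<in> chow_class n q" for x y
    using chow_ideal_add[of "x - p" n "y - q"] that by (simp add: in_chow_class_iff algebra_simps)
  ultimately show ?thesis
    unfolding set_add_def' by auto
qed

text \<open>The action is an elementwise image, so the inclusion from right to left needs a preimage
  of each element. The inverse permutation supplies it and preserves the ideal too.\<close>

lemma chow_action_class:
  assumes "\<sigma> permutes {1..n}"
  shows "chow_action \<sigma> (chow_class n p) = chow_class n (perm_poly \<sigma> p)"
proof (intro equalityI subsetI)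
  fix q assume "q \<in> chow_action \<sigma> (chow_class n p)"
  then obtain r where "q = perm_poly \<sigma> r" "r - p \<in> chow_ideal n"
    by (auto simp: chow_action_def in_chow_class_iff)
  then show "q \<in> chow_class n (perm_poly \<sigma> p)"
    using chow_ideal_perm_poly[OF assms] by (auto simp: in_chow_class_iff simp flip: perm_poly_simps(3))
next
  fix q assume "q \<in> chow_class n (perm_poly \<sigma> p)"
  then have "perm_poly (inv_into UNIV \<sigma>) (q - perm_poly \<sigma> p) \<in> chow_ideal n"
    using chow_ideal_perm_poly[OF permutes_inv[OF assms]] by (simp add: in_chow_class_iff)
  then have "perm_poly (inv_into UNIV \<sigma>) q \<in> chow_class n p"
    by (simp add: in_chow_class_iff perm_poly_simps perm_poly_inv[OF assms])
  then have "perm_poly \<sigma> (perm_poly (inv_into UNIV \<sigma>) q) \<in> chow_action \<sigma> (chow_class n p)"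
    unfolding chow_action_def by (rule imageI)
  then show "q \<in> chow_action \<sigma> (chow_class n p)"
    by (simp add: perm_poly_inv[OF assms])
qed

lemma rat_field_simps [simp]:
  "carrier rat_field = UNIV" "a \<otimes>\<^bsub>rat_field\<^esub> b = a * b" "a \<oplus>\<^bsub>rat_field\<^esub> b = a + b"
  "\<one>\<^bsub>rat_field\<^esub> = 1" "\<zero>\<^bsub>rat_field\<^esub> = 0"
  by (simp_all add: rat_field_def ring_of_type_algebra_def)

lemma field_rat_field: "field rat_field"
  unfolding rat_field_def by (rule field_from_type_algebra)

text \<open>A common form for the algebra (\<open>D\<close> all polynomials) and its components
  (\<open>D\<close> the homogeneous ones). \<open>D\<close> consists of representatives, not of
  classes.\<close>

definition chow_subspace :: "nat \<Rightarrow> flat_poly set \<Rightarrow> (rat, flat_poly set) module"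
  where "chow_subspace n D = chow_algebra n\<lparr>carrier := chow_class n ` D\<rparr>"

lemma chow_subspace_simps:
  "carrier (chow_subspace n D) = chow_class n ` D"
  "\<zero>\<^bsub>chow_subspace n D\<^esub> = chow_class n 0"
  "chow_class n p \<oplus>\<^bsub>chow_subspace n D\<^esub> chow_class n q = chow_class n (p + q)"
  "p \<in> flat_polys n \<Longrightarrow> c \<odot>\<^bsub>chow_subspace n D\<^esub> chow_class n p = chow_class n (poly_const c * p)"
proof -
  show "c \<odot>\<^bsub>chow_subspace n D\<^esub> chow_class n p = chow_class n (poly_const c * p)" if "p \<in> flat_polys n"
    using ideal.rcoset_mult_add[OF ideal_chow_ideal, of "poly_const c" n p] that
    by (simp add: chow_subspace_def chow_algebra_def Let_def FactRing_def chow_class_def)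
qed (simp_all add: chow_subspace_def chow_algebra_def Let_def FactRing_def chow_class_0 chow_class_add)

lemma chow_subspace_all: "chow_subspace n (flat_polys n) = chow_algebra n"
proof -
  have "carrier (chow_algebra n) = chow_class n ` flat_polys n"
    unfolding chow_algebra_def Let_def FactRing_def chow_class_def A_RCOSETS_def' by auto
  then show ?thesis
    by (simp add: chow_subspace_def)
qed

lemma chow_subspace_homogeneous:
  "chow_subspace n {p \<in> flat_polys n. homogeneous_poly k p} = chow_component n k"
  by (simp add: chow_subspace_def chow_component_def)

text \<open>Spanning and independence are phrased for polynomials modulo the ideal, the form in
  which straightening and evaluation deliver them. The passage to cosets, vector spaces and group
  actions is then made once for the algebra and all components.\<close>

locale chow_invariant_subspace =
  fixes n :: nat and D B :: "flat_poly set"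
  assumes D_flat: "D \<subseteq> flat_polys n"
    and D_0: "0 \<in> D"
    and D_add: "p \<in> D \<Longrightarrow> q \<in> D \<Longrightarrow> p + q \<in> D"
    and D_scale: "p \<in> D \<Longrightarrow> poly_const r * p \<in> D"
    and D_perm: "\<sigma> permutes {1..n} \<Longrightarrow> p \<in> D \<Longrightarrow> perm_poly \<sigma> p \<in> D"
    and B_D: "B \<subseteq> D"
    and fin_B: "finite B"
    and spanning: "p \<in> D \<Longrightarrow> \<exists>c. p - (\<Sum>b\<in>B. poly_const (c b) * b) \<in> chow_ideal n"
    and independent: "(\<Sum>b\<in>B. poly_const (c b) * b) \<in> chow_ideal n \<Longrightarrow> b \<in> B \<Longrightarrow> c b = 0"
    and B_perm: "\<sigma> permutes {1..n} \<Longrightarrow> b \<in> B \<Longrightarrow> perm_poly \<sigma> b \<in> B"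
begin

abbreviation V where "V \<equiv> chow_subspace n D"

lemma smult_class: "p \<in> D \<Longrightarrow> c \<odot>\<^bsub>V\<^esub> chow_class n p = chow_class n (poly_const c * p)"
  by (rule chow_subspace_simps(4)) (use D_flat in auto)

lemmas V_simps = chow_subspace_simps(1-3) smult_class

lemma vectorspace_V: "vectorspace rat_field V"
proof -
  interpret K: field rat_field by (rule field_rat_field)
  have "module rat_field V"
  proof (rule module_criteria, goal_cases)
    \<comment> \<open>This criterion asks for additive inverses; the witness is the class of
      \<open>p\<close> scaled by -1.\<close>
    case 4
    have "\<exists>w\<in>carrier V. chow_class n p \<oplus>\<^bsub>V\<^esub> w = \<zero>\<^bsub>V\<^esub>" if "p \<in> D" for p
      using D_scale[OF that, of "-1"]
      by (intro bexI[of _ "chow_class n (poly_const (-1) * p)"]) (simp_all add: V_simps poly_const.hom_uminus)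
    then show ?case
      by (auto simp: V_simps(1))
  qed (auto simp: V_simps D_0 D_add D_scale K.is_cring poly_const.hom_add poly_const.hom_mult
      distrib_left distrib_right mult.assoc add_ac)
  then show ?thesis
    by (simp add: vectorspace_def field_rat_field)
qed

lemma finsum_class:
  assumes "finite A" "\<And>i. i \<in> A \<Longrightarrow> g i \<in> D"
  shows "(\<Oplus>\<^bsub>V\<^esub>i\<in>A. chow_class n (g i)) = chow_class n (\<Sum>i\<in>A. g i) \<and> (\<Sum>i\<in>A. g i) \<in> D"
proof -
  interpret V: vectorspace rat_field V by (rule vectorspace_V)
  show ?thesis
    using assms
  proof (induction A rule: finite_induct)
    case empty
    then show ?case by (simp add: V_simps D_0)
  next
    case (insert i A)
    then show ?case
      by (subst V.finsum_insert) (auto simp: V_simps D_add)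
  qed
qed

text \<open>Two elements of \<open>B\<close> with the same class would give a relation with
  coefficients 1 and -1. Injectivity lets linear combinations over the set of classes be reindexed
  by \<open>B\<close>.\<close>

lemma inj_on_class: "inj_on (chow_class n) B"
proof (rule inj_onI, rule ccontr)
  fix a b assume ab: "a \<in> B" "b \<in> B" "chow_class n a = chow_class n b" "a \<noteq> b"
  let ?c = "\<lambda>x. if x = a then 1 else if x = b then -1 else 0 :: rat"
  have "(\<Sum>x\<in>B. poly_const (?c x) * x) = (\<Sum>x\<in>B. (if x = a then a else 0) - (if x = b then b else 0))"
    using ab by (intro sum.cong) (auto simp: poly_const.hom_uminus)
  also have "\<dots> = a - b"
    using ab fin_B by (simp add: sum_subtractf)
  finally have "?c a = 0"
    using independent[of ?c a] ab by (simp add: chow_class_eq_iff)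
  then show False by simp
qed

lemma lincomb_class:
  "module.lincomb V a (chow_class n ` B) = chow_class n (\<Sum>b\<in>B. poly_const (a (chow_class n b)) * b)"
proof -
  interpret V: vectorspace rat_field V by (rule vectorspace_V)
  have "(\<Oplus>\<^bsub>V\<^esub>v\<in>chow_class n ` B. a v \<odot>\<^bsub>V\<^esub> v) = (\<Oplus>\<^bsub>V\<^esub>b\<in>B. a (chow_class n b) \<odot>\<^bsub>V\<^esub> chow_class n b)"
    using B_D D_scale by (intro V.finsum_reindex inj_on_class) (auto simp: V_simps)
  also have "\<dots> = (\<Oplus>\<^bsub>V\<^esub>b\<in>B. chow_class n (poly_const (a (chow_class n b)) * b))"
    using B_D D_scale by (intro V.finsum_cong') (auto simp: V_simps)
  also have "\<dots> = chow_class n (\<Sum>b\<in>B. poly_const (a (chow_class n b)) * b)"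
    using B_D D_scale fin_B by (intro finsum_class[THEN conjunct1]) auto
  finally show ?thesis
    by (simp add: V.lincomb_def)
qed

lemma basis_V: "vectorspace.basis rat_field V (chow_class n ` B)"
proof -
  interpret V: vectorspace rat_field V by (rule vectorspace_V)
  have fin: "finite (chow_class n ` B)" using fin_B by simp
  have sub: "chow_class n ` B \<subseteq> carrier V" using B_D by (auto simp: V_simps)
  have "V.lin_indpt (chow_class n ` B)"
  proof (rule V.finite_lin_indpt2[OF fin sub])
    fix a assume "V.lincomb a (chow_class n ` B) = \<zero>\<^bsub>V\<^esub>"
    then have "(\<Sum>b\<in>B. poly_const (a (chow_class n b)) * b) \<in> chow_ideal n"
      unfolding lincomb_class V_simps chow_class_eq_iff by simp
    then show "\<forall>v\<in>chow_class n ` B. a v = \<zero>\<^bsub>rat_field\<^esub>"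
      using independent[of "\<lambda>b. a (chow_class n b)"] by auto
  qed
  moreover have "V.span (chow_class n ` B) = carrier V"
  proof
    show "V.span (chow_class n ` B) \<subseteq> carrier V"
      using sub by (rule V.span_is_subset2)
    show "carrier V \<subseteq> V.span (chow_class n ` B)"
    proof
      fix v assume "v \<in> carrier V"
      then obtain p where p: "p \<in> D" "v = chow_class n p" by (auto simp: V_simps)
      then obtain c where c: "p - (\<Sum>b\<in>B. poly_const (c b) * b) \<in> chow_ideal n" using spanning by blast
      define a where "a w = c (the_inv_into B (chow_class n) w)" for w
      have "(\<Sum>b\<in>B. poly_const (a (chow_class n b)) * b) = (\<Sum>b\<in>B. poly_const (c b) * b)"
        by (intro sum.cong) (simp_all add: a_def the_inv_into_f_f[OF inj_on_class])
      then have "v = V.lincomb a (chow_class n ` B)"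
        using c p by (simp add: lincomb_class chow_class_eq_iff)
      then show "v \<in> V.span (chow_class n ` B)"
        unfolding V.finite_span[OF fin sub] by auto
    qed
  qed
  ultimately show ?thesis
    using sub by (simp add: V.basis_def)
qed

lemma bij_betw_action:
  assumes "\<sigma> permutes {1..n}"
  shows "bij_betw (chow_action \<sigma>) (carrier V) (carrier V)"
  by (rule bij_betw_byWitness[where f' = "chow_action (inv_into UNIV \<sigma>)"])
    (use assms permutes_inv[OF assms] D_perm in
      \<open>auto simp: V_simps chow_action_class perm_poly_inv[OF assms]\<close>)

lemma group_action_V:
  "group_action (sym_group n) (carrier V) (\<lambda>\<sigma>. restrict (chow_action \<sigma>) (carrier V))"
proof (intro group_action.intro group_hom.intro group_hom_axioms.intro homI)
  fix \<sigma> assume "\<sigma> \<in> carrier (sym_group n)"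
  then have "\<sigma> permutes {1..n}" by (simp only: sym_group_carrier)
  then show "restrict (chow_action \<sigma>) (carrier V) \<in> carrier (BijGroup (carrier V))"
    using bij_betw_action by (simp add: BijGroup_def Bij_def)
next
  fix \<sigma> \<tau> assume "\<sigma> \<in> carrier (sym_group n)" "\<tau> \<in> carrier (sym_group n)"
  then have perm: "\<sigma> permutes {1..n}" "\<tau> permutes {1..n}" by (simp_all only: sym_group_carrier)
  have Bij: "restrict (chow_action \<sigma>) (carrier V) \<in> Bij (carrier V)" if "\<sigma> permutes {1..n}" for \<sigma>
    using bij_betw_action[OF that] by (simp add: Bij_def)
  have "chow_action \<tau> v \<in> carrier V" "chow_action (\<sigma> \<circ> \<tau>) v = chow_action \<sigma> (chow_action \<tau> v)"
    if "v \<in> carrier V" for v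
    using bij_betwE[OF bij_betw_action[OF perm(2)]] that
    by (auto simp: chow_action_def perm_poly_comp image_image)
  then show "restrict (chow_action (\<sigma> \<otimes>\<^bsub>sym_group n\<^esub> \<tau>)) (carrier V)
      = restrict (chow_action \<sigma>) (carrier V) \<otimes>\<^bsub>BijGroup (carrier V)\<^esub> restrict (chow_action \<tau>) (carrier V)"
    using perm Bij by (auto simp: sym_group_mult BijGroup_def compose_def fun_eq_iff)
qed (rule sym_group_is_group group_BijGroup)+

lemma linear_rep_V: "linear_rep (sym_group n) rat_field V chow_action"
proof -
  have "chow_action \<sigma> \<in> module_hom rat_field V V" if "\<sigma> \<in> carrier (sym_group n)" for \<sigma>
  proof -
    have "\<sigma> permutes {1..n}" using that by (simp only: sym_group_carrier)
    then show ?thesis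
      by (auto simp: module_hom_def V_simps chow_action_class D_perm D_add D_scale perm_poly_simps perm_poly_const)
  qed
  then show ?thesis
    by (simp add: linear_rep_def vectorspace_V group_action_V)
qed

lemma permutation_basis_V: "permutation_basis (sym_group n) rat_field V chow_action (chow_class n ` B)"
proof -
  have "chow_action \<sigma> ` chow_class n ` B = chow_class n ` B" if "\<sigma> \<in> carrier (sym_group n)" for \<sigma>
  proof -
    have \<sigma>: "\<sigma> permutes {1..n}" using that by (simp only: sym_group_carrier)
    \<comment> \<open>Both the permutation and its inverse map \<open>B\<close> into itself, which
      forces equality.\<close>
    have "perm_poly \<sigma> ` B = B"
    proof (intro equalityI subsetI)
      fix b assume "b \<in> B"
      then have "perm_poly \<sigma> (perm_poly (inv_into UNIV \<sigma>) b) \<in> perm_poly \<sigma> ` B"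
        using B_perm[OF permutes_inv[OF \<sigma>]] by (intro imageI)
      then show "b \<in> perm_poly \<sigma> ` B" by (simp add: perm_poly_inv[OF \<sigma>])
    qed (use B_perm[OF \<sigma>] in auto)
    then show ?thesis
      by (metis (no_types, lifting) chow_action_class[OF \<sigma>] image_cong image_image)
  qed
  then show ?thesis
    by (simp add: permutation_basis_def linear_rep_V basis_V)
qed

end

lemma fy_exponents_flat: "m \<in> fy_exponents n {} \<Longrightarrow> Poly_Mapping.keys m \<subseteq> nonempty_flats n"
  by (auto simp: fy_exponents_def nonempty_flats_def)

lemma chow_invariant_subspace_all: "chow_invariant_subspace n (flat_polys n) (FY n)"
proof -
  have sum: "(\<Sum>b\<in>FY n. poly_const (c b) * b) = fy_sum n (\<lambda>m. c (monomial m))" for c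
    unfolding FY_eq fy_sum_def by (subst sum.reindex) (auto simp: inj_on_def)
  show ?thesis
  proof
    show "FY n \<subseteq> flat_polys n"
      using fy_exponents_flat by (auto simp: FY_eq)
    show "finite (FY n)" by (simp add: FY_eq)
    show "\<exists>c. p - (\<Sum>b\<in>FY n. poly_const (c b) * b) \<in> chow_ideal n" if p: "p \<in> flat_polys n" for p
    proof -
      obtain c where "p - fy_sum n c \<in> chow_ideal n" using fy_spanning[OF p] by blast
      then show ?thesis
        \<comment> \<open>Coefficients indexed by exponents are transported to the monomials along
          the injection \<open>monomial\<close>.\<close>
        unfolding sum by (intro exI[of _ "\<lambda>b. c (the_inv monomial b)"]) (simp add: the_inv_f_f inj_def)
    qed
    show "c b = 0" if "(\<Sum>b\<in>FY n. poly_const (c b) * b) \<in> chow_ideal n" "b \<in> FY n" for c b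
    proof -
      obtain m where m: "m \<in> fy_exponents n {}" "b = monomial m"
        using \<open>b \<in> _\<close> by (auto simp: FY_eq)
      then show ?thesis
        using fy_independent[OF _ m(1)] that(1) unfolding sum by fastforce
    qed
  qed (auto simp: flat_polys_perm_poly FY_perm_poly)
qed

lemma chow_invariant_subspace_homogeneous:
  "chow_invariant_subspace n {p \<in> flat_polys n. homogeneous_poly k p} (FY_deg n k)"
proof -
  have sum: "(\<Sum>b\<in>FY_deg n k. poly_const (c b) * b) = fy_combination n k (\<lambda>m. c (monomial m))" for c
    unfolding FY_deg_eq fy_combination_def by (subst sum.reindex) (auto simp: inj_on_def)
  show ?thesis
  proof
    show "FY_deg n k \<subseteq> {p \<in> flat_polys n. homogeneous_poly k p}"
      using chow_invariant_subspace.B_D[OF chow_invariant_subspace_all] by (auto simp: FY_deg_def)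
    show "finite (FY_deg n k)" by (simp add: FY_deg_eq)
    show "\<exists>c. p - (\<Sum>b\<in>FY_deg n k. poly_const (c b) * b) \<in> chow_ideal n"
      if p: "p \<in> {p \<in> flat_polys n. homogeneous_poly k p}" for p
    proof -
      obtain c where "p - fy_combination n k c \<in> chow_ideal n"
        using fy_reducible_homogeneous[of p n k] p unfolding fy_reducible_def by blast
      then show ?thesis
        unfolding sum by (intro exI[of _ "\<lambda>b. c (the_inv monomial b)"]) (simp add: the_inv_f_f inj_def)
    qed
    show "c b = 0" if "(\<Sum>b\<in>FY_deg n k. poly_const (c b) * b) \<in> chow_ideal n" "b \<in> FY_deg n k" for c b
    proof -
      obtain m where m: "m \<in> fy_exponents n {}" "total_degree m = k" "b = monomial m"
        using \<open>b \<in> _\<close> by (auto simp: FY_deg_eq)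
      then show ?thesis
        using fy_independent[OF _ m(1)] that(1) unfolding sum fy_combination_eq_fy_sum by fastforce
    qed
  qed (auto simp: flat_polys_perm_poly FY_perm_poly FY_deg_def homogeneous_add homogeneous_scale homogeneous_perm_poly)
qed

text \<open>Injectivity is stated separately because a basis is a set of classes, and as such it
  would not notice two monomials sharing a class.\<close>

theorem proposition3p5:
  fixes n :: nat
  assumes "n \<ge> 1"
  shows "inj_on (chow_class n) (FY n)
    \<and> permutation_basis (sym_group n) rat_field (chow_algebra n) chow_action (chow_class n ` FY n)
    \<and> (\<forall>k \<in> {0..n - 1}. inj_on (chow_class n) (FY_deg n k)
         \<and> permutation_basis (sym_group n) rat_field (chow_component n k) chow_action
             (chow_class n ` FY_deg n k))"
  using chow_invariant_subspace.inj_on_class[OF chow_invariant_subspace_all]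
    chow_invariant_subspace.permutation_basis_V[OF chow_invariant_subspace_all]
    chow_invariant_subspace.inj_on_class[OF chow_invariant_subspace_homogeneous]
    chow_invariant_subspace.permutation_basis_V[OF chow_invariant_subspace_homogeneous]
  by (simp add: chow_subspace_all chow_subspace_homogeneous)

end
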